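(* Let $G$ be a countable group and let $(\mathbf{X},T)$ be an ergodic dynamical system, where $T$ is an action of $G$ by measure-preserving transformations on a standard probability space $\mathbf{X}=(X,\mathscr{X},\mu)$. Suppose that the Pinsker factor of $(\mathbf{X},T)$ with respect to Rokhlin entropy is nonatomic, i.e. its underlying probability space has no atoms. Then $(\mathbf{X},T)$ is a relatively weakly mixing extension of its Pinsker factor.
   Context: A standard probability space (Lebesgue space) is the (completed) measure space arising from a Borel probability measure on a standard Borel space. A dynamical system is a pair $(\mathbf{X},T)$ where $\mathbf{X}=(X,\mathscr{X},\mu)$ is a standard probability space and $T$ is an action of a countable group $G$ on it by measure-preserving transformations $T^g$, $g\in G$. A $\sigma$-subalgebra $\mathscr{A}\subseteq\mathscr{X}$ is complete if $A\in\mathscr{A}$, $B\in\mathscr{X}$ and $\mu(A\Delta B)=0$ imply $B\in\mathscr{A}$. It is invariant if $T^g(A)\in\mathscr{A}$ for all $A\in\mathscr{A}$, $g\in G$. A factor of $(\mathbf{X},T)$ is a dynamical system $(\mathbf{Y},S)$ with the same acting group together with an equivariant measure-preserving map $\pi:\mathbf{X}\to\mathbf{Y}$; then $(\mathbf{X},T)$ (with $\pi$) is called an extension of $(\mathbf{Y},S)$. The complete invariant $\sigma$-subalgebra corresponding to a factor is the completion of $\{\pi^{-1}(A): A\in\mathscr{Y}\}$. Every complete invariant $\sigma$-subalgebra of $\mathscr{X}$ corresponds in this way to a factor (unique up to isomorphism). A partition is a finite or countable collection of disjoint measurable subsets of $X$ covering $X$; it is $\mathscr{A}$-measurable if all its elements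 belong to $\mathscr{A}$. The Shannon entropy of a partition $\alpha=\{A_1,A_2,\ldots\}$ is $H(\alpha)=-\sum_i\mu(A_i)\log\mu(A_i)\in[0,\infty]$, with $0\log 0=0$. A partition $\alpha$ generates the smallest complete invariant $\sigma$-subalgebra with respect to which $\alpha$ is measurable. The Rokhlin entropy of a complete invariant $\sigma$-subalgebra $\mathscr{A}$ is $h(\mathscr{A})=\inf\{H(\alpha):\alpha \text{ is an } \mathscr{A}\text{-measurable partition generating } \mathscr{A}\}$, where the infimum of the empty set is $+\infty$. Every dynamical system has a unique maximal (with respect to inclusion) element among its complete invariant $\sigma$-subalgebras of zero Rokhlin entropy, called the Pinsker subalgebra. The Pinsker factor is the factor corresponding to the Pinsker subalgebra. An extension $(\mathbf{X},T)$ of $(\mathbf{Y},S)$ is relatively weakly mixing over $(\mathbf{Y},S)$ if for every ergodic extension $(\mathbf{X}',T')$ of $(\mathbf{Y},S)$ the relatively independent joining of $(\mathbf{X},T)$ and $(\mathbf{X}',T')$ over the common factor $(\mathbf{Y},S)$ is ergodic. Here, if $\mu=\int\mu_y\,d\nu(y)$ and $\mu'=\int\mu'_y\,d\nu(y)$ are the disintegrations over $\mathbf{Y}=(Y,\mathscr{Y},\nu)$, the relatively independent joining is $X\times X'$ with the measure $\int\mu_y\times\mu'_y\,d\nu(y)$ and the diagonal action $T^g\times T'^g$. *)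

theory Defs
  imports "HOL-Probability.Probability" "HOL-Algebra.Group_Action"
begin

section \<open>Standard probability spaces\<close>

definition standard_borel :: "'a measure \<Rightarrow> bool" where
  "standard_borel N \<longleftrightarrow>
    (\<exists>X. completely_metrizable_space X \<and> separable_space X \<and>
         topspace X = space N \<and> sets N = sigma_sets (topspace X) {U. openin X U})"

text \<open>\<^term>\<open>N\<close> is an uncompleted Borel space whose completion is \<^term>\<open>M\<close>. Disintegrations are
  formulated on such a model, since the conditional measures need not be defined on all of the
  completed \<open>\<sigma>\<close>-algebra.\<close>

definition borel_model :: "'a measure \<Rightarrow> 'a measure \<Rightarrow> bool" where
  "borel_model N M \<longleftrightarrow> prob_space N \<and> standard_borel N \<and> M = completion N"

definition standard_probability_space :: "'a measure \<Rightarrow> bool" where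
  "standard_probability_space M \<longleftrightarrow> (\<exists>N. borel_model N M)"

definition nonatomic :: "'a measure \<Rightarrow> bool" where
  "nonatomic M \<longleftrightarrow>
    \<not> (\<exists>A\<in>sets M. emeasure M A > 0 \<and>
         (\<forall>B\<in>sets M. B \<subseteq> A \<longrightarrow> emeasure M B = 0 \<or> emeasure M B = emeasure M A))"


section \<open>Dynamical systems and factors\<close>

definition measure_preserving :: "'a measure \<Rightarrow> 'b measure \<Rightarrow> ('a \<Rightarrow> 'b) \<Rightarrow> bool" where
  "measure_preserving M N f \<longleftrightarrow> f \<in> M \<rightarrow>\<^sub>M N \<and> distr M N f = N"

locale dynamical_system = group_action G "space M" T
  for G :: "('g, 'm) monoid_scheme" and M :: "'a measure" and T :: "'g \<Rightarrow> 'a \<Rightarrow> 'a" +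
  assumes countable_group: "countable (carrier G)"
    and standard: "standard_probability_space M"
    and preserving: "g \<in> carrier G \<Longrightarrow> measure_preserving M M (T g)"

definition ergodic ::
    "('g, 'm) monoid_scheme \<Rightarrow> 'a measure \<Rightarrow> ('g \<Rightarrow> 'a \<Rightarrow> 'a) \<Rightarrow> bool" where
  "ergodic G M T \<longleftrightarrow>
    (\<forall>A\<in>sets M. (\<forall>g\<in>carrier G. T g ` A = A) \<longrightarrow> emeasure M A = 0 \<or> emeasure M A = 1)"

text \<open>As usual for maps between probability spaces, equivariance is only required almost
  everywhere.\<close>

definition factor_map ::
    "('g, 'm) monoid_scheme \<Rightarrow> 'a measure \<Rightarrow> ('g \<Rightarrow> 'a \<Rightarrow> 'a) \<Rightarrow>
     'b measure \<Rightarrow> ('g \<Rightarrow> 'b \<Rightarrow> 'b) \<Rightarrow> ('a \<Rightarrow> 'b) \<Rightarrow> bool" where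
  "factor_map G M T Y S p \<longleftrightarrow>
    dynamical_system G M T \<and> dynamical_system G Y S \<and> measure_preserving M Y p \<and>
    (\<forall>g\<in>carrier G. AE x in M. p (T g x) = S g (p x))"


section \<open>Complete invariant subalgebras\<close>

definition complete_invariant_subalgebra ::
    "('g, 'm) monoid_scheme \<Rightarrow> 'a measure \<Rightarrow> ('g \<Rightarrow> 'a \<Rightarrow> 'a) \<Rightarrow> 'a set set \<Rightarrow> bool" where
  "complete_invariant_subalgebra G M T \<A> \<longleftrightarrow>
    sigma_algebra (space M) \<A> \<and> \<A> \<subseteq> sets M \<and>
    (\<forall>A\<in>\<A>. \<forall>B\<in>sets M. emeasure M (sym_diff A B) = 0 \<longrightarrow> B \<in> \<A>) \<and>
    (\<forall>A\<in>\<A>. \<forall>g\<in>carrier G. T g ` A \<in> \<A>)"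

definition factor_subalgebra :: "'a measure \<Rightarrow> 'b measure \<Rightarrow> ('a \<Rightarrow> 'b) \<Rightarrow> 'a set set" where
  "factor_subalgebra M Y p =
    {B \<in> sets M. \<exists>A\<in>sets Y. emeasure M (sym_diff (p -` A \<inter> space M) B) = 0}"


section \<open>Rokhlin entropy\<close>

definition countable_partition :: "'a measure \<Rightarrow> 'a set set \<Rightarrow> bool" where
  "countable_partition M \<alpha> \<longleftrightarrow>
    countable \<alpha> \<and> \<alpha> \<subseteq> sets M \<and> disjoint \<alpha> \<and> \<Union>\<alpha> = space M"

text \<open>The convention \<open>0 log 0 = 0\<close> holds because \<^term>\<open>ln (0::real) = 0\<close>.\<close>

definition shannon_entropy :: "'a measure \<Rightarrow> 'a set set \<Rightarrow> ennreal" where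
  "shannon_entropy M \<alpha> = (\<Sum>\<^sub>\<infinity>A\<in>\<alpha>. ennreal (- (measure M A * ln (measure M A))))"

definition generated_subalgebra ::
    "('g, 'm) monoid_scheme \<Rightarrow> 'a measure \<Rightarrow> ('g \<Rightarrow> 'a \<Rightarrow> 'a) \<Rightarrow> 'a set set \<Rightarrow> 'a set set" where
  "generated_subalgebra G M T \<alpha> = \<Inter>{\<A>. complete_invariant_subalgebra G M T \<A> \<and> \<alpha> \<subseteq> \<A>}"

definition rokhlin_entropy ::
    "('g, 'm) monoid_scheme \<Rightarrow> 'a measure \<Rightarrow> ('g \<Rightarrow> 'a \<Rightarrow> 'a) \<Rightarrow> 'a set set \<Rightarrow> ennreal" where
  "rokhlin_entropy G M T \<A> =
    Inf {shannon_entropy M \<alpha> | \<alpha>.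
      countable_partition M \<alpha> \<and> \<alpha> \<subseteq> \<A> \<and> generated_subalgebra G M T \<alpha> = \<A>}"

definition zero_entropy_subalgebra ::
    "('g, 'm) monoid_scheme \<Rightarrow> 'a measure \<Rightarrow> ('g \<Rightarrow> 'a \<Rightarrow> 'a) \<Rightarrow> 'a set set \<Rightarrow> bool" where
  "zero_entropy_subalgebra G M T \<A> \<longleftrightarrow>
    complete_invariant_subalgebra G M T \<A> \<and> rokhlin_entropy G M T \<A> = 0"

text \<open>Such a maximal element is unique, but the definition does not rely on this.\<close>

definition pinsker_subalgebra ::
    "('g, 'm) monoid_scheme \<Rightarrow> 'a measure \<Rightarrow> ('g \<Rightarrow> 'a \<Rightarrow> 'a) \<Rightarrow> 'a set set \<Rightarrow> bool" where
  "pinsker_subalgebra G M T \<A> \<longleftrightarrow>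
    zero_entropy_subalgebra G M T \<A> \<and>
    (\<forall>\<B>. zero_entropy_subalgebra G M T \<B> \<longrightarrow> \<A> \<subseteq> \<B> \<longrightarrow> \<B> = \<A>)"

text \<open>The Pinsker factor is unique only up to isomorphism; any system realizing the Pinsker
  subalgebra qualifies.\<close>

definition pinsker_factor ::
    "('g, 'm) monoid_scheme \<Rightarrow> 'a measure \<Rightarrow> ('g \<Rightarrow> 'a \<Rightarrow> 'a) \<Rightarrow>
     'b measure \<Rightarrow> ('g \<Rightarrow> 'b \<Rightarrow> 'b) \<Rightarrow> ('a \<Rightarrow> 'b) \<Rightarrow> bool" where
  "pinsker_factor G M T Y S p \<longleftrightarrow>
    factor_map G M T Y S p \<and> pinsker_subalgebra G M T (factor_subalgebra M Y p)"


section \<open>Relative weak mixing\<close>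

text \<open>\<^term>\<open>\<kappa> y\<close> is the measure \<open>\<mu>\<^sub>y\<close> on the fibre of \<^term>\<open>p\<close> over \<^term>\<open>y\<close>, and
  \<^term>\<open>Giry_Monad.bind Y \<kappa>\<close> is the integral of these measures over \<^term>\<open>Y\<close>.\<close>

definition disintegration ::
    "'a measure \<Rightarrow> 'b measure \<Rightarrow> ('a \<Rightarrow> 'b) \<Rightarrow> ('b \<Rightarrow> 'a measure) \<Rightarrow> bool" where
  "disintegration N Y p \<kappa> \<longleftrightarrow>
    \<kappa> \<in> Y \<rightarrow>\<^sub>M prob_algebra N \<and> N = Giry_Monad.bind Y \<kappa> \<and> (AE y in Y. AE x in \<kappa> y. p x = y)"

text \<open>The completed joining depends neither on the Borel models nor on the choice of
  disintegrations.\<close>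

definition relatively_independent_joining ::
    "'a measure \<Rightarrow> ('a \<Rightarrow> 'b) \<Rightarrow> 'c measure \<Rightarrow> ('c \<Rightarrow> 'b) \<Rightarrow> 'b measure \<Rightarrow>
     ('a \<times> 'c) measure \<Rightarrow> bool" where
  "relatively_independent_joining M p M' p' Y J \<longleftrightarrow>
    (\<exists>N N' \<kappa> \<kappa>'. borel_model N M \<and> borel_model N' M' \<and>
       disintegration N Y p \<kappa> \<and> disintegration N' Y p' \<kappa>' \<and>
       J = completion (Giry_Monad.bind Y (\<lambda>y. \<kappa> y \<Otimes>\<^sub>M \<kappa>' y)))"

definition diagonal_action ::
    "'a measure \<Rightarrow> ('g \<Rightarrow> 'a \<Rightarrow> 'a) \<Rightarrow> 'c measure \<Rightarrow> ('g \<Rightarrow> 'c \<Rightarrow> 'c) \<Rightarrow>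
     'g \<Rightarrow> 'a \<times> 'c \<Rightarrow> 'a \<times> 'c" where
  "diagonal_action M T M' T' g = restrict (map_prod (T g) (T' g)) (space M \<times> space M')"

text \<open>A definition cannot quantify over types, so the type \<^typ>\<open>'c\<close> of the points of the test
  extensions is a parameter; a theorem in which \<^typ>\<open>'c\<close> is a free type variable covers test
  extensions over every type.\<close>

definition relatively_weakly_mixing ::
    "'c itself \<Rightarrow> ('g, 'm) monoid_scheme \<Rightarrow> 'a measure \<Rightarrow> ('g \<Rightarrow> 'a \<Rightarrow> 'a) \<Rightarrow>
     'b measure \<Rightarrow> ('g \<Rightarrow> 'b \<Rightarrow> 'b) \<Rightarrow> ('a \<Rightarrow> 'b) \<Rightarrow> bool" where
  "relatively_weakly_mixing (_ :: 'c itself) G M T Y S p \<longleftrightarrow>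
    factor_map G M T Y S p \<and>
    (\<forall>(M' :: 'c measure) T' p' J.
       factor_map G M' T' Y S p' \<longrightarrow> ergodic G M' T' \<longrightarrow>
       relatively_independent_joining M p M' p' Y J \<longrightarrow>
       ergodic G J (diagonal_action M T M' T'))"

end

theory Submission
  imports Defs
begin

text \<open>Let \<open>A\<close> be an invariant set of the relatively independent joining with an ergodic extension
  \<open>X'\<close>, with sections \<open>A\<^sub>x\<close>. The functions \<open>x \<mapsto> \<mu>'\<^sub>y(A\<^sub>x \<inter> B)\<close>, where \<open>y = p x\<close>, generate together
  with the Pinsker subalgebra a complete invariant subalgebra. It has zero Rokhlin entropy: the
  distance \<open>\<mu>'\<^sub>y(A\<^sub>x \<triangle> A\<^sub>z)\<close> between points of the same fibre is invariant, so by ergodicity a single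
  set of positive measure on whose fibres this distance is at most \<open>\<epsilon>\<close> determines, through its
  translates, all \<open>A\<^sub>x\<close> up to \<open>\<epsilon>\<close>; as the Pinsker factor is nonatomic, such sets can be chosen
  arbitrarily small, hence with arbitrarily small entropy. By maximality of the Pinsker subalgebra
  the functions above factor through \<open>p\<close>, and then ergodicity of \<open>X'\<close> forces \<open>A\<close> to be trivial.\<close>

section \<open>Countably generated measure spaces\<close>

text \<open>The completed spaces carry the dynamics, but the conditional measures exist only on
  Borel models, and equivariance holds only almost everywhere. Identities are therefore reached
  through Borel versions and exceptional null sets, which can be united because the group is
  countable and each Borel model has a countable generating algebra. That algebra also spares
  comparing pairs of points in a fibre: a section is compared with a reference set \<open>E\<close>
  from it. Countably many \<open>E\<close> approximate every section to within
  \<open>\<epsilon>\<close>, so one of them does so on a set of positive measure, and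
  \<open>\<epsilon> = 1/(n+1)\<close> for all \<open>n\<close> together pins the sections down.
  Nonatomicity serves to shrink these sets: cutting them with small sets of the factor keeps them in
  the enlarged subalgebra and of positive measure, which is all that covering the space by
  translates asks of them. The two ergodicity hypotheses act in different places: that of
  \<open>X\<close> makes the translates of the small sets cover the space, that of \<open>X'\<close>
  makes the sections in the other direction have constant measure.\<close>

lemma algebra_approximation:
  assumes "finite_measure M" and alg: "algebra \<Omega> \<V>"
    and sets: "sets M = sigma_sets \<Omega> \<V>" and "space M = \<Omega>"
    and "A \<in> sets M" and "\<epsilon> > 0"
  shows "\<exists>E\<in>\<V>. measure M (sym_diff A E) < \<epsilon>"
proof -
  interpret finite_measure M by fact
  interpret V: algebra \<Omega> \<V> by fact
  have V_sets: "E \<in> \<V> \<Longrightarrow> E \<in> sets M" for E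
    unfolding sets by auto
  have "A \<in> sigma_sets \<Omega> \<V>" using \<open>A \<in> sets M\<close> sets by simp
  then have "\<forall>\<epsilon>>0. \<exists>E\<in>\<V>. measure M (sym_diff A E) < \<epsilon>"
  proof (induction rule: sigma_sets.induct)
    case (Basic a)
    then show ?case by (intro allI impI bexI[of _ a]) auto
  next
    case Empty
    then show ?case by (intro allI impI bexI[of _ "{}"]) auto
  next
    case (Compl a)
    show ?case
    proof (intro allI impI)
      fix \<epsilon> :: real assume "\<epsilon> > 0"
      then obtain E where E: "E \<in> \<V>" "measure M (sym_diff a E) < \<epsilon>" using Compl by blast
      have "a \<subseteq> \<Omega>" "E \<subseteq> \<Omega>"
        using Compl.hyps E(1) sets \<open>space M = \<Omega>\<close> sets.sets_into_space V_sets by blast+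
      then have "sym_diff (\<Omega> - a) (\<Omega> - E) = sym_diff a E" by auto
      then show "\<exists>E\<in>\<V>. measure M (sym_diff (\<Omega> - a) E) < \<epsilon>"
        using E by (intro bexI[of _ "\<Omega> - E"]) auto
    qed
  next
    case (Union a)
    show ?case
    proof (intro allI impI)
      fix \<epsilon> :: real assume "\<epsilon> > 0"
      have aM: "a i \<in> sets M" for i using Union.hyps sets by simp
      \<comment> \<open>Half of \<open>\<epsilon>\<close> is shared geometrically among the
        \<open>a i\<close>; the other half pays for cutting the union off at a finite
        \<open>n\<close>, since an algebra has only finite unions.\<close>
      have "\<exists>E\<in>\<V>. measure M (sym_diff (a i) E) < \<epsilon> / 2 * (1/2) ^ Suc i" for i
        by (rule Union.IH[rule_format]) (use \<open>\<epsilon> > 0\<close> in simp)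
      then obtain E where E: "\<And>i. E i \<in> \<V>"
        "\<And>i. measure M (sym_diff (a i) (E i)) < \<epsilon> / 2 * (1/2) ^ Suc i" by metis
      have EM: "E i \<in> sets M" for i using E(1) V_sets by blast
      have "(\<lambda>n. measure M (\<Union>i<n. a i)) \<longlonglongrightarrow> measure M (\<Union>n. \<Union>i<n. a i)"
        by (rule finite_Lim_measure_incseq) (auto simp: incseq_def aM intro!: less_le_trans)
      moreover have "(\<Union>n. \<Union>i<n. a i) = (\<Union>i. a i)" by auto
      ultimately have "(\<lambda>n. measure M (\<Union>i<n. a i)) \<longlonglongrightarrow> measure M (\<Union>i. a i)" by simp
      then obtain n where n: "\<bar>measure M (\<Union>i<n. a i) - measure M (\<Union>i. a i)\<bar> < \<epsilon> / 2"
        using \<open>\<epsilon> > 0\<close> by (auto simp: lim_sequentially dist_real_def dest!: spec[of _ "\<epsilon> / 2"])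
      have "measure M ((\<Union>i. a i) - (\<Union>i<n. a i)) = measure M (\<Union>i. a i) - measure M (\<Union>i<n. a i)"
        using aM by (intro finite_measure_Diff) auto
      then have tail: "measure M ((\<Union>i. a i) - (\<Union>i<n. a i)) < \<epsilon> / 2" using n by linarith
      have "measure M (\<Union>i<n. sym_diff (a i) (E i)) \<le> (\<Sum>i<n. measure M (sym_diff (a i) (E i)))"
        using aM EM by (intro finite_measure_subadditive_finite) auto
      also have "\<dots> \<le> (\<Sum>i<n. \<epsilon> / 2 * (1/2) ^ Suc i)"
        using E(2) by (intro sum_mono less_imp_le)
      also have "\<dots> = \<epsilon> / 2 * (\<Sum>i<n. (1/2) ^ Suc i)" by (simp add: sum_distrib_left)
      also have "(\<Sum>i<n. (1/2::real) ^ Suc i) = 1 - (1/2)^n" by (induction n) auto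
      also have "\<epsilon> / 2 * (1 - (1/2)^n) \<le> \<epsilon> / 2" using \<open>\<epsilon> > 0\<close> by (simp add: mult_le_cancel_left1)
      finally have head: "measure M (\<Union>i<n. sym_diff (a i) (E i)) \<le> \<epsilon> / 2" .
      have "measure M (sym_diff (\<Union>i. a i) (\<Union>i<n. E i))
        \<le> measure M (((\<Union>i. a i) - (\<Union>i<n. a i)) \<union> (\<Union>i<n. sym_diff (a i) (E i)))"
        using aM EM by (intro finite_measure_mono) (auto, blast?)
      also have "\<dots> \<le> measure M ((\<Union>i. a i) - (\<Union>i<n. a i)) + measure M (\<Union>i<n. sym_diff (a i) (E i))"
        using aM EM by (intro measure_Un_le) auto
      also have "\<dots> < \<epsilon>" using head tail by linarith
      finally show "\<exists>E\<in>\<V>. measure M (sym_diff (\<Union>i. a i) E) < \<epsilon>"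
        using E(1) by (intro bexI[of _ "\<Union>i<n. E i"]) auto
    qed
  qed
  then show ?thesis using \<open>\<epsilon> > 0\<close> by blast
qed

lemma countable_generated_algebra:
  assumes "countable \<U>" "\<U> \<subseteq> Pow \<Omega>"
  shows "\<exists>\<V>. countable \<V> \<and> algebra \<Omega> \<V> \<and> \<U> \<subseteq> \<V> \<and> \<V> \<subseteq> sigma_sets \<Omega> \<U>"
proof -
  define F where "F = (\<lambda>\<V>. \<V> \<union> (\<lambda>a. \<Omega> - a) ` \<V> \<union> (\<lambda>(a, b). a \<union> b) ` (\<V> \<times> \<V>))"
  define V where "V n = (F ^^ n) (insert {} \<U>)" for n
  have V_Suc: "V (Suc n) = F (V n)" for n by (simp add: V_def)
  have mono: "m \<le> n \<Longrightarrow> V m \<subseteq> V n" for m n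
    by (rule lift_Suc_mono_le[of V]) (auto simp: V_Suc F_def)
  have count: "countable (V n)" for n
    by (induction n) (auto simp: V_Suc F_def V_def[of 0] assms)
  have sig: "V n \<subseteq> sigma_sets \<Omega> \<U>" for n
  proof (induction n)
    case 0
    then show ?case by (auto simp: V_def sigma_sets.Empty)
  next
    case (Suc n)
    then show ?case
      by (auto simp: V_Suc F_def intro!: sigma_sets.Compl sigma_sets_Un)
  qed
  have "algebra \<Omega> (\<Union>n. V n)"
    unfolding algebra_iff_Un
  proof (intro conjI ballI)
    show "(\<Union>n. V n) \<subseteq> Pow \<Omega>"
      using sig sigma_sets_into_sp[OF assms(2)] by blast
    show "{} \<in> (\<Union>n. V n)" by (auto simp: V_def intro!: exI[of _ 0])
  next
    fix a assume "a \<in> (\<Union>n. V n)"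
    then obtain n where "a \<in> V n" by blast
    then have "\<Omega> - a \<in> V (Suc n)" by (auto simp: V_Suc F_def)
    then show "\<Omega> - a \<in> (\<Union>n. V n)" by blast
  next
    fix a b assume "a \<in> (\<Union>n. V n)" "b \<in> (\<Union>n. V n)"
    then obtain m n where "a \<in> V m" "b \<in> V n" by blast
    then have "a \<in> V (max m n)" "b \<in> V (max m n)"
      using mono[of m "max m n"] mono[of n "max m n"] by auto
    then have "a \<union> b \<in> V (Suc (max m n))" by (force simp: V_Suc F_def)
    then show "a \<union> b \<in> (\<Union>n. V n)" by blast
  qed
  moreover have "\<U> \<subseteq> (\<Union>n. V n)" by (auto simp: V_def intro!: exI[of _ 0])
  ultimately show ?thesis
    using count sig by (intro exI[of _ "\<Union>n. V n"]) auto
qed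

text \<open>The balls of radius \<open>1/(n+1)\<close> around a countable dense set form a base, and
  the algebra they generate is still countable. Being closed under intersections it determines
  measures, and being independent of any measure it serves all conditional measures at once.\<close>

lemma standard_borel_countable_algebra:
  assumes "standard_borel N"
  obtains \<V> where "countable \<V>" "algebra (space N) \<V>" "sets N = sigma_sets (space N) \<V>"
proof -
  obtain X where X: "completely_metrizable_space X" "separable_space X" "topspace X = space N"
    "sets N = sigma_sets (topspace X) {U. openin X U}"
    using assms unfolding standard_borel_def by blast
  from completely_metrizable_imp_metrizable_space[OF X(1)]
  obtain \<Omega> d where \<Omega>: "Metric_space \<Omega> d" "X = Metric_space.mtopology \<Omega> d"
    unfolding metrizable_space_def by blast
  interpret Metric_space \<Omega> d by fact
  obtain C where C: "countable C" "C \<subseteq> \<Omega>" "mtopology closure_of C = \<Omega>"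
    using X(2) \<Omega>(2) unfolding separable_space_def by auto
  define \<U> where "\<U> = (\<lambda>(c, n). mball c (1 / Suc n)) ` (C \<times> (UNIV :: nat set))"
  have \<U>: "countable \<U>" "\<U> \<subseteq> Pow \<Omega>"
    using C(1) by (auto simp: \<U>_def)
  have "U \<in> sigma_sets \<Omega> \<U>" if U: "openin mtopology U" for U
  proof -
    have "\<exists>B\<in>\<U>. x \<in> B \<and> B \<subseteq> U" if "x \<in> U" for x
    proof -
      obtain r where r: "r > 0" "mball x r \<subseteq> U" using U \<open>x \<in> U\<close> openin_mtopology by blast
      \<comment> \<open>Half the radius, because the ball is centred at the nearby point
        \<open>c\<close> and must both contain \<open>x\<close> and stay within \<open>r\<close> of
        it.\<close>
      obtain n where n: "1 / real (Suc n) < r / 2" using r(1) nat_approx_posE[of "r / 2"] by auto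
      have x: "x \<in> \<Omega>" using U \<open>x \<in> U\<close> openin_subset by force
      then have "x \<in> mtopology closure_of C" using C(3) by simp
      then obtain c where c: "c \<in> C" "c \<in> mball x (1 / Suc n)"
        unfolding metric_closure_of by auto (metis in_mball of_nat_0_less_iff zero_less_Suc zero_less_divide_1_iff of_nat_Suc)
      have "x \<in> mball c (1 / Suc n)" using c by (auto simp: commute)
      moreover have "mball c (1 / Suc n) \<subseteq> mball x r"
      proof
        fix z assume z: "z \<in> mball c (1 / Suc n)"
        then have "d x z \<le> d x c + d c z" using x by (intro triangle) auto
        then show "z \<in> mball x r" using z c(2) n x by auto
      qed
      ultimately show ?thesis using r(2) c(1)
        by (intro bexI[of _ "mball c (1 / Suc n)"]) (auto simp: \<U>_def simp del: of_nat_Suc)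
    qed
    then have "U = \<Union>{B\<in>\<U>. B \<subseteq> U}" by blast
    also have "\<dots> \<in> sigma_sets \<Omega> \<U>"
      using \<U>(1) sigma_algebra.countable_Union[OF sigma_algebra_sigma_sets[OF \<U>(2)], of "{B\<in>\<U>. B \<subseteq> U}"]
      by (auto intro: countable_subset)
    finally show ?thesis .
  qed
  then have le: "sets N \<subseteq> sigma_sets \<Omega> \<U>"
    unfolding X(4) using \<Omega>(2) by (auto intro!: sigma_sets_mono)
  have ge: "\<U> \<subseteq> sets N"
    unfolding X(4) by (auto simp: \<U>_def \<Omega>(2))
  obtain \<V> where V: "countable \<V>" "algebra \<Omega> \<V>" "\<U> \<subseteq> \<V>" "\<V> \<subseteq> sigma_sets \<Omega> \<U>"
    using countable_generated_algebra[OF \<U>] by blast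
  have sp: "space N = \<Omega>" using X(3) \<Omega>(2) by simp
  have "sets N = sigma_sets \<Omega> \<V>"
  proof
    show "sets N \<subseteq> sigma_sets \<Omega> \<V>" using le sigma_sets_subseteq[OF V(3)] by blast
    have "\<V> \<subseteq> sets N" using V(4) sets.sigma_sets_subset[OF ge] sp by blast
    then show "sigma_sets \<Omega> \<V> \<subseteq> sets N" using sets.sigma_sets_subset[of \<V> N] sp by blast
  qed
  then show ?thesis using that V sp by simp
qed

text \<open>The preimage of each of the countably many generators differs from a set of
  \<open>N\<close> by a subset of a null set; making the map constant on the union of these null
  sets makes all preimages measurable at once. This is needed because the action is measurable only
  for the completion, while conditional measures see only \<open>sets N\<close>.\<close>

lemma completion_borel_version:
  assumes f: "f \<in> completion N \<rightarrow>\<^sub>M K" and sets: "sets K = sigma_sets (space K) \<V>"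
    and "countable \<V>" and "\<V> \<subseteq> Pow (space K)"
  obtains t where "t \<in> N \<rightarrow>\<^sub>M K" "AE x in N. t x = f x"
proof -
  have "\<exists>B Z. B \<in> sets N \<and> Z \<in> null_sets N \<and> sym_diff (f -` V \<inter> space N) B \<subseteq> Z" if "V \<in> \<V>" for V
  proof -
    have "V \<in> sets K" using that sets by auto
    from measurable_sets[OF f this] have "f -` V \<inter> space N \<in> sets (completion N)" by simp
    then obtain S Q Q' where "f -` V \<inter> space N = S \<union> Q" "Q \<subseteq> Q'" "Q' \<in> null_sets N" "S \<in> sets N"
      using sets_completionE[of _ N] by metis
    then show ?thesis by (intro exI[of _ S] exI[of _ Q']) auto
  qed
  then obtain B Z where B: "\<And>V. V \<in> \<V> \<Longrightarrow> B V \<in> sets N"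
    and Z: "\<And>V. V \<in> \<V> \<Longrightarrow> Z V \<in> null_sets N"
    and BZ: "\<And>V. V \<in> \<V> \<Longrightarrow> sym_diff (f -` V \<inter> space N) (B V) \<subseteq> Z V" by metis
  define Z0 where "Z0 = (\<Union>V\<in>\<V>. Z V)"
  have Z0: "Z0 \<in> null_sets N" unfolding Z0_def using \<open>countable \<V>\<close> Z by (rule null_sets_UN')
  show ?thesis
  proof (cases "space N = {}")
    case True
    have "f \<in> N \<rightarrow>\<^sub>M K" using True by (auto simp: measurable_def space_empty_iff)
    then show ?thesis using that by blast
  next
    case False
    then obtain x0 where "x0 \<in> space N" by blast
    then have k: "f x0 \<in> space K" using measurable_space[OF f] by simp
    define t where "t x = (if x \<in> Z0 then f x0 else f x)" for x
    have fx: "x \<in> space N \<Longrightarrow> f x \<in> space K" for x using measurable_space[OF f] by simp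
    have "t \<in> measurable N (sigma (space K) \<V>)"
    proof (rule measurable_sigma_sets[OF _ assms(4)])
      show "sets (sigma (space K) \<V>) = sigma_sets (space K) \<V>" using assms(4) by simp
      show "t \<in> space N \<rightarrow> space K" using k fx by (auto simp: t_def)
      fix V assume V: "V \<in> \<V>"
      have Z0s: "Z0 \<subseteq> space N" and BVs: "B V \<subseteq> space N"
        using Z0 B[OF V] sets.sets_into_space by auto
      have "x \<in> f -` V \<inter> space N \<longleftrightarrow> x \<in> B V" if "x \<notin> Z0" for x
        using BZ[OF V] V that by (auto simp: Z0_def)
      then have "t -` V \<inter> space N = (B V - Z0) \<union> (if f x0 \<in> V then Z0 else {})"
        using Z0s BVs by (auto simp: t_def split: if_splits) blast+
      then show "t -` V \<inter> space N \<in> sets N" using B[OF V] Z0 by auto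
    qed
    moreover have "measurable N (sigma (space K) \<V>) = measurable N K"
      using assms(4) sets by (intro measurable_cong_sets) auto
    moreover have "AE x in N. t x = f x"
      using AE_not_in[OF Z0] by eventually_elim (auto simp: t_def)
    ultimately show ?thesis using that by blast
  qed
qed

section \<open>Shannon entropy\<close>

text \<open>Turns the sum in \<open>shannon_entropy\<close> into an integral, so that Tonelli's
  theorem and additivity are at hand.\<close>

lemma infsum_eq_nn_integral_count_space:
  fixes f :: "'a \<Rightarrow> ennreal"
  assumes "countable A"
  shows "infsum f A = (\<integral>\<^sup>+x. f x \<partial>count_space A)"
proof (rule antisym)
  have eq: "infsum f A = (SUP F\<in>{F. finite F \<and> F \<subseteq> A}. sum f F)"
    by (rule nonneg_infsum_complete) simp
  show "infsum f A \<le> (\<integral>\<^sup>+x. f x \<partial>count_space A)"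
    unfolding eq
  proof (rule SUP_least)
    fix F assume F: "F \<in> {F. finite F \<and> F \<subseteq> A}"
    then have "sum f F = (\<integral>\<^sup>+x. f x \<partial>count_space F)"
      by (simp add: nn_integral_count_space_finite)
    also have "\<dots> \<le> (\<integral>\<^sup>+x. f x \<partial>count_space A)"
      using F by (subst (1 2) nn_integral_count_space_indicator)
        (auto intro!: nn_integral_mono simp: indicator_def)
    finally show "sum f F \<le> (\<integral>\<^sup>+x. f x \<partial>count_space A)" .
  qed
  show "(\<integral>\<^sup>+x. f x \<partial>count_space A) \<le> infsum f A"
  proof (cases "finite A")
    case True
    then show ?thesis by (simp add: nn_integral_count_space_finite)
  next
    case False
    let ?g = "from_nat_into A"
    have bij: "bij_betw ?g UNIV A" using assms False by (rule bij_betw_from_nat_into)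
    have "(\<integral>\<^sup>+x. f x \<partial>count_space A) = (\<Sum>i. f (?g i))"
      using nn_integral_bij_count_space[OF bij, of f] by (simp add: nn_integral_count_space_nat)
    also have "\<dots> = (SUP n. \<Sum>i<n. f (?g i))" by (rule suminf_eq_SUP)
    also have "\<dots> \<le> infsum f A"
      unfolding eq
    proof (rule SUP_least)
      fix n :: nat
      have inj: "inj_on ?g {..<n}" using bij by (auto simp: bij_betw_def inj_on_def)
      have "(\<Sum>i<n. f (?g i)) = sum f (?g ` {..<n})" using inj by (simp add: sum.reindex)
      also have "\<dots> \<le> (SUP F\<in>{F. finite F \<and> F \<subseteq> A}. sum f F)"
        using bij by (intro SUP_upper) (auto simp: bij_betw_def)
      finally show "(\<Sum>i<n. f (?g i)) \<le> (SUP F\<in>{F. finite F \<and> F \<subseteq> A}. sum f F)" .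
    qed
    finally show ?thesis .
  qed
qed

text \<open>A partition is a set of sets, so an indexed family may list a member repeatedly, for
  instance the empty set among intersections; choosing one index per value leaves a subsum of
  nonnegative terms.\<close>

lemma infsum_ennreal_image_le:
  fixes f :: "'b \<Rightarrow> ennreal"
  shows "infsum f (h ` I) \<le> infsum (\<lambda>i. f (h i)) I"
proof -
  obtain J where J: "J \<subseteq> I" "h ` J = h ` I" "inj_on h J"
    by (metis subset_image_inj order_refl)
  have "infsum f (h ` I) = infsum (\<lambda>i. f (h i)) J"
    using infsum_reindex[OF J(3), of f] J(2) by (simp add: o_def)
  also have "\<dots> \<le> infsum (\<lambda>i. f (h i)) I"
    using J(1) by (intro infsum_mono_neutral nonneg_summable_on_complete) auto
  finally show ?thesis .
qed

section \<open>Common refinements and subadditivity of entropy\<close>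

definition join_partition :: "'a set set \<Rightarrow> 'a set set \<Rightarrow> 'a set set" where
  "join_partition \<alpha> \<beta> = (\<lambda>(A, B). A \<inter> B) ` (\<alpha> \<times> \<beta>)"

lemma countable_partition_join:
  assumes "countable_partition M \<alpha>" "countable_partition M \<beta>"
  shows "countable_partition M (join_partition \<alpha> \<beta>)"
  unfolding countable_partition_def
proof (intro conjI)
  have d: "\<And>A B. A \<in> \<alpha> \<Longrightarrow> B \<in> \<alpha> \<Longrightarrow> A \<noteq> B \<Longrightarrow> A \<inter> B = {}" "\<And>A B. A \<in> \<beta> \<Longrightarrow> B \<in> \<beta> \<Longrightarrow> A \<noteq> B \<Longrightarrow> A \<inter> B = {}"
    using assms by (auto simp: countable_partition_def disjoint_def)
  show "disjoint (join_partition \<alpha> \<beta>)"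
  proof (rule disjointI)
    fix C C' assume "C \<in> join_partition \<alpha> \<beta>" "C' \<in> join_partition \<alpha> \<beta>" "C \<noteq> C'"
    then obtain A B A' B' where C: "C = A \<inter> B" "C' = A' \<inter> B'" "A \<in> \<alpha>" "A' \<in> \<alpha>" "B \<in> \<beta>" "B' \<in> \<beta>" "A \<noteq> A' \<or> B \<noteq> B'"
      unfolding join_partition_def by fast
    then show "C \<inter> C' = {}" using d(1)[of A A'] d(2)[of B B'] by auto
  qed
  have "\<Union>(join_partition \<alpha> \<beta>) = \<Union>\<alpha> \<inter> \<Union>\<beta>"
    unfolding join_partition_def by fast
  then show "\<Union>(join_partition \<alpha> \<beta>) = space M"
    using assms unfolding countable_partition_def by simp
qed (use assms in \<open>auto simp: countable_partition_def join_partition_def\<close>)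

lemma (in prob_space) sum_partition_emeasure:
  assumes "countable_partition M \<beta>" "A \<in> sets M"
  shows "(\<integral>\<^sup>+B. emeasure M (A \<inter> B) \<partial>count_space \<beta>) = emeasure M A"
proof -
  have "emeasure M (\<Union>B\<in>\<beta>. A \<inter> B) = (\<integral>\<^sup>+B. emeasure M (A \<inter> B) \<partial>count_space \<beta>)"
    using assms unfolding countable_partition_def
    by (intro emeasure_UN_countable) (auto simp: disjoint_family_on_def disjoint_def)
  moreover have "(\<Union>B\<in>\<beta>. A \<inter> B) = A"
    using assms sets.sets_into_space[of A M] unfolding countable_partition_def by blast
  ultimately show ?thesis by simp
qed

text \<open>This is \<open>ln u \<le> u - 1\<close> at \<open>u = a * b / m\<close>, the pointwise
  form of the nonnegativity of mutual information. The summand \<open>m\<close> stays on the left so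
  that all terms are nonnegative and can be read in \<open>ennreal\<close>.\<close>

lemma entropy_term_bound:
  fixes m a b :: real
  assumes "0 \<le> m" "m \<le> a" "m \<le> b" "a \<le> 1" "b \<le> 1"
  shows "ennreal (- (m * ln m)) + ennreal m
    \<le> ennreal (- ln a) * ennreal m + ennreal (- ln b) * ennreal m + ennreal a * ennreal b"
proof (cases "m = 0")
  case False
  then have pos: "0 < m" "0 < a" "0 < b" using assms by auto
  have "ln (a * b / m) \<le> a * b / m - 1" using pos by (intro ln_le_minus_one) auto
  then have "m * ln (a * b / m) \<le> m * (a * b / m - 1)" using pos by (intro mult_left_mono) auto
  also have "\<dots> = a * b - m" using pos by (simp add: field_simps)
  finally have "- (m * ln m) + m \<le> - ln a * m + - ln b * m + a * b"
    using pos by (simp add: ln_div ln_mult field_simps)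
  then have "ennreal (- (m * ln m) + m) \<le> ennreal (- ln a * m + - ln b * m + a * b)"
    by (rule ennreal_leI)
  moreover have "0 \<le> - (m * ln m)" "0 \<le> - ln a" "0 \<le> - ln b"
    using pos assms by (auto simp: mult_nonneg_nonpos)
  ultimately show ?thesis
    using pos by (simp only: ennreal_plus ennreal_mult mult_nonneg_nonneg add_nonneg_nonneg less_imp_le)
qed auto

lemma (in prob_space) shannon_entropy_join_le:
  assumes \<alpha>: "countable_partition M \<alpha>" and \<beta>: "countable_partition M \<beta>"
  shows "shannon_entropy M (join_partition \<alpha> \<beta>) \<le> shannon_entropy M \<alpha> + shannon_entropy M \<beta>"
proof -
  have [simp]: "countable \<alpha>" "countable \<beta>" "\<And>A. A \<in> \<alpha> \<Longrightarrow> A \<in> sets M" "\<And>A. A \<in> \<beta> \<Longrightarrow> A \<in> sets M"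
    using \<alpha> \<beta> unfolding countable_partition_def by auto
  have prod: "count_space (\<alpha> \<times> \<beta>) = count_space \<alpha> \<Otimes>\<^sub>M count_space \<beta>"
    by (rule pair_measure_countable[symmetric]) auto
  interpret A: sigma_finite_measure "count_space \<alpha>" by (rule sigma_finite_measure_count_space_countable) simp
  interpret B: sigma_finite_measure "count_space \<beta>" by (rule sigma_finite_measure_count_space_countable) simp
  interpret AB: pair_sigma_finite "count_space \<alpha>" "count_space \<beta>" ..
  have fst: "(\<integral>\<^sup>+z. f z \<partial>count_space (\<alpha> \<times> \<beta>)) = (\<integral>\<^sup>+A. \<integral>\<^sup>+B. f (A, B) \<partial>count_space \<beta> \<partial>count_space \<alpha>)" for f :: "_ \<Rightarrow> ennreal"
    unfolding prod by (rule B.nn_integral_fst[symmetric]) (simp add: prod[symmetric])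
  have snd: "(\<integral>\<^sup>+z. f z \<partial>count_space (\<alpha> \<times> \<beta>)) = (\<integral>\<^sup>+B. \<integral>\<^sup>+A. f (A, B) \<partial>count_space \<alpha> \<partial>count_space \<beta>)" for f :: "_ \<Rightarrow> ennreal"
    unfolding prod by (rule AB.nn_integral_snd[symmetric]) (simp add: prod[symmetric])
  let ?e = "\<lambda>t. ennreal (- (t * ln t))"
  have eta: "ennreal (- ln (prob A)) * emeasure M A = ?e (prob A)" for A
  proof (cases "prob A = 0")
    case False
    then have "0 < prob A" by (simp add: less_le)
    then have "ln (prob A) \<le> 0" by simp
    then show ?thesis by (simp add: emeasure_eq_measure ennreal_mult[symmetric] mult.commute)
  qed (simp add: emeasure_eq_measure)
  have one: "(\<integral>\<^sup>+A. emeasure M A \<partial>count_space \<alpha>) = 1" if "countable_partition M \<alpha>" for \<alpha>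
  proof -
    have "(\<integral>\<^sup>+A. emeasure M A \<partial>count_space \<alpha>) = (\<integral>\<^sup>+A. emeasure M (space M \<inter> A) \<partial>count_space \<alpha>)"
      using that by (intro nn_integral_cong) (auto simp: countable_partition_def Int_absorb1 sets.sets_into_space subset_iff)
    then show ?thesis using sum_partition_emeasure[OF that, of "space M"] emeasure_space_1 by simp
  qed
  have "shannon_entropy M (join_partition \<alpha> \<beta>) \<le> (\<Sum>\<^sub>\<infinity>z\<in>\<alpha>\<times>\<beta>. ?e (prob (fst z \<inter> snd z)))"
    unfolding shannon_entropy_def join_partition_def
    using infsum_ennreal_image_le[of "\<lambda>A. ?e (prob A)" "\<lambda>(A,B). A \<inter> B" "\<alpha> \<times> \<beta>"]
    by (simp add: case_prod_unfold)
  also have "\<dots> = (\<integral>\<^sup>+z. ?e (prob (fst z \<inter> snd z)) \<partial>count_space (\<alpha> \<times> \<beta>))" (is "_ = ?I")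
    by (rule infsum_eq_nn_integral_count_space) simp
  finally have le: "shannon_entropy M (join_partition \<alpha> \<beta>) \<le> ?I" .
  have "(\<integral>\<^sup>+z. emeasure M (fst z \<inter> snd z) \<partial>count_space (\<alpha> \<times> \<beta>)) = (\<integral>\<^sup>+A. emeasure M A \<partial>count_space \<alpha>)"
    unfolding fst by (intro nn_integral_cong) (simp add: sum_partition_emeasure[OF \<beta>])
  \<comment> \<open>\<open>?I\<close> may be infinite, so nothing is subtracted from it; the masses
    of the pairs, which add up to 1, are added instead, and the finite 1 is cancelled at the
    end.\<close>
  then have "?I + 1 = ?I + (\<integral>\<^sup>+z. emeasure M (fst z \<inter> snd z) \<partial>count_space (\<alpha> \<times> \<beta>))"
    using one[OF \<alpha>] by simp
  also have "\<dots> = (\<integral>\<^sup>+z. ?e (prob (fst z \<inter> snd z)) + emeasure M (fst z \<inter> snd z) \<partial>count_space (\<alpha> \<times> \<beta>))"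
    by (rule nn_integral_add[symmetric]) auto
  also have "\<dots> \<le> (\<integral>\<^sup>+z. ennreal (- ln (prob (fst z))) * emeasure M (fst z \<inter> snd z)
      + ennreal (- ln (prob (snd z))) * emeasure M (fst z \<inter> snd z)
      + emeasure M (fst z) * emeasure M (snd z) \<partial>count_space (\<alpha> \<times> \<beta>))"
    unfolding emeasure_eq_measure
    by (intro nn_integral_mono entropy_term_bound finite_measure_mono) auto
  also have "\<dots> = (\<integral>\<^sup>+z. ennreal (- ln (prob (fst z))) * emeasure M (fst z \<inter> snd z) \<partial>count_space (\<alpha> \<times> \<beta>))
      + (\<integral>\<^sup>+z. ennreal (- ln (prob (snd z))) * emeasure M (fst z \<inter> snd z) \<partial>count_space (\<alpha> \<times> \<beta>))
      + (\<integral>\<^sup>+z. emeasure M (fst z) * emeasure M (snd z) \<partial>count_space (\<alpha> \<times> \<beta>))"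
    by (subst nn_integral_add; simp?) (subst nn_integral_add; simp?)
  also have "(\<integral>\<^sup>+z. ennreal (- ln (prob (fst z))) * emeasure M (fst z \<inter> snd z) \<partial>count_space (\<alpha> \<times> \<beta>))
      = (\<integral>\<^sup>+A. ?e (prob A) \<partial>count_space \<alpha>)"
    unfolding fst by (intro nn_integral_cong) (simp add: nn_integral_cmult sum_partition_emeasure[OF \<beta>] eta)
  also have "(\<integral>\<^sup>+z. ennreal (- ln (prob (snd z))) * emeasure M (fst z \<inter> snd z) \<partial>count_space (\<alpha> \<times> \<beta>))
      = (\<integral>\<^sup>+A. ?e (prob A) \<partial>count_space \<beta>)"
    unfolding snd using sum_partition_emeasure[OF \<alpha>]
    by (intro nn_integral_cong) (simp add: nn_integral_cmult eta Int_commute)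
  also have "(\<integral>\<^sup>+z. emeasure M (fst z) * emeasure M (snd z) \<partial>count_space (\<alpha> \<times> \<beta>)) = 1"
    unfolding fst by (simp add: nn_integral_cmult one[OF \<alpha>] one[OF \<beta>])
  finally have "?I \<le> (\<integral>\<^sup>+A. ?e (prob A) \<partial>count_space \<alpha>) + (\<integral>\<^sup>+A. ?e (prob A) \<partial>count_space \<beta>)"
    using ennreal_add_left_cancel_le[of 1] by (simp add: add.commute)
  then show ?thesis
    using le by (simp add: shannon_entropy_def infsum_eq_nn_integral_count_space)
qed

text \<open>The inequality \<open>ln u \<le> u - 1\<close> at \<open>u = 1 / sqrt t\<close> gives
  the bound \<open>2 * sqrt t\<close>. Measures bounded by squares of a geometric sequence thus have
  summable entropy terms.\<close>

lemma entropy_term_le_sqrt: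
  fixes t c :: real
  assumes "0 \<le> t" "t \<le> c^2" "0 \<le> c"
  shows "- (t * ln t) \<le> 2 * c"
proof (cases "t = 0")
  case False
  then have t: "0 < t" using assms by simp
  have "ln (1 / sqrt t) \<le> 1 / sqrt t - 1" using t by (intro ln_le_minus_one) auto
  then have "- ln t \<le> 2 * (1 / sqrt t - 1)" using t by (simp add: ln_div ln_sqrt)
  then have "t * (- ln t) \<le> t * (2 * (1 / sqrt t - 1))" using t by (intro mult_left_mono) auto
  also have "\<dots> = 2 * (t / sqrt t) - 2 * t" by (simp add: field_simps)
  also have "t / sqrt t = sqrt t" using t by (simp add: real_div_sqrt)
  also have "2 * sqrt t - 2 * t \<le> 2 * sqrt t" using t by simp
  also have "sqrt t \<le> c" using assms real_le_lsqrt by blast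
  finally show ?thesis by simp
qed (use assms in auto)

text \<open>The cells \<open>D n\<close> contribute at most the sum of
  \<open>2 * c * (1/2)^n\<close>, which is \<open>4 * c\<close>. The remaining cell contributes at
  most the measure of its complement, by \<open>- r * ln r \<le> 1 - r\<close>, hence at most
  \<open>2 * c\<close>.\<close>

lemma (in prob_space) shannon_entropy_small_sets:
  assumes D: "\<And>n. D n \<in> sets M" "disjoint_family D"
    and small: "\<And>n. prob (D n) \<le> (c * (1/2)^n)^2" and c: "0 \<le> c" "c \<le> 1"
  defines "\<delta> \<equiv> insert (space M - (\<Union>n. D n)) (range D)"
  shows "countable_partition M \<delta>" "shannon_entropy M \<delta> \<le> ennreal (6 * c)"
proof -
  have sub: "D n \<subseteq> space M" for n using D(1) sets.sets_into_space by blast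
  have "disjoint \<delta>"
    using disjoint_family_on_disjoint_image[OF D(2)] unfolding \<delta>_def disjoint_def by auto
  then show "countable_partition M \<delta>"
    using D(1) sub unfolding countable_partition_def \<delta>_def by auto
  let ?e = "\<lambda>t. ennreal (- (t * ln t))"
  let ?R = "space M - (\<Union>n. D n)"
  have geo: "(\<lambda>n. c * (1/2)^n) sums (2 * c)"
    using sums_mult[OF geometric_sums[of "1/2::real"], of c] by (simp add: mult.commute[of c 2])
  have s: "summable (\<lambda>n. c * (1/2)^n)" "(\<Sum>n. c * (1/2)^n) = 2 * c"
    using geo by (simp_all add: sums_iff)
  have sq: "(c * (1/2)^n)^2 \<le> c * (1/2)^n" for n
  proof -
    have "c * (1/2)^n \<le> 1" using c by (intro mult_le_one) (auto simp: power_le_one)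
    then show ?thesis using c by (simp add: power2_eq_square mult_left_le)
  qed
  have le: "prob (D n) \<le> c * (1/2)^n" for n by (rule order_trans[OF small sq])
  have sD: "summable (\<lambda>n. prob (D n))"
    by (rule summable_comparison_test'[OF s(1), of 0]) (simp add: le)
  have "prob (\<Union>n. D n) \<le> (\<Sum>n. prob (D n))"
    using D sD by (intro finite_measure_subadditive_countably) auto
  also have "\<dots> \<le> (\<Sum>n. c * (1/2)^n)"
    by (intro suminf_le s sD le)
  finally have U: "prob (\<Union>n. D n) \<le> 2 * c" using s by simp
  have R: "- (prob ?R * ln (prob ?R)) \<le> 2 * c"
  proof (cases "prob ?R = 0")
    case False
    then have r: "0 < prob ?R" by (simp add: less_le)
    have "ln (1 / prob ?R) \<le> 1 / prob ?R - 1" using r by (intro ln_le_minus_one) auto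
    then have "prob ?R * (- ln (prob ?R)) \<le> prob ?R * (1 / prob ?R - 1)"
      using r by (intro mult_left_mono) (auto simp: ln_div)
    also have "\<dots> = 1 - prob ?R" using r by (simp add: field_simps)
    also have "\<dots> = prob (\<Union>n. D n)" using D by (subst prob_compl) auto
    finally show ?thesis using U by simp
  qed (use c in simp)
  have "shannon_entropy M \<delta> \<le> (\<Sum>\<^sub>\<infinity>A\<in>{?R} \<union> range D. ?e (prob A))"
    by (simp add: shannon_entropy_def \<delta>_def)
  also have "\<dots> \<le> ?e (prob ?R) + (\<Sum>\<^sub>\<infinity>A\<in>range D. ?e (prob A))"
  \<comment> \<open>\<open>?R\<close> is disjoint from every \<open>D n\<close>, so it can be one of
    them only when empty.\<close>
  proof (cases "?R \<in> range D")
    case True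
    then show ?thesis by (simp add: insert_absorb)
  next
    case False
    then show ?thesis
      by (subst infsum_Un_disjoint) (auto intro: nonneg_summable_on_complete)
  qed
  also have "(\<Sum>\<^sub>\<infinity>A\<in>range D. ?e (prob A)) \<le> (\<Sum>\<^sub>\<infinity>n. ?e (prob (D n)))"
    by (rule infsum_ennreal_image_le)
  also have "\<dots> = (\<Sum>n. ?e (prob (D n)))"
    by (simp add: infsum_eq_nn_integral_count_space nn_integral_count_space_nat)
  also have "\<dots> \<le> (\<Sum>n. ennreal (2 * (c * (1/2)^n)))"
    using c small by (intro suminf_le ennreal_leI entropy_term_le_sqrt) auto
  also have "\<dots> = ennreal (\<Sum>n. 2 * (c * (1/2)^n))"
    using c s by (intro suminf_ennreal2) (auto intro: summable_mult)
  also have "(\<Sum>n. 2 * (c * (1/2)^n)) = 4 * c" using s by (simp add: suminf_mult)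
  also have "?e (prob ?R) \<le> ennreal (2 * c)" using R by (rule ennreal_leI)
  also have "ennreal (2 * c) + ennreal (4 * c) = ennreal (6 * c)"
    using c by (simp add: ennreal_plus[symmetric] del: ennreal_plus)
  finally show "shannon_entropy M \<delta> \<le> ennreal (6 * c)" by (simp add: add_mono)
qed

section \<open>Ergodic actions\<close>

context dynamical_system
begin

sublocale prob_space M
  using standard prob_space.prob_space_completion
  unfolding standard_probability_space_def borel_model_def by blast

lemma inv_closed: "g \<in> carrier G \<Longrightarrow> inv\<^bsub>G\<^esub> g \<in> carrier G"
  using group_hom group.inv_closed by (metis group_hom.axioms(1))

lemma one_closed: "\<one>\<^bsub>G\<^esub> \<in> carrier G"
  using group_hom group.is_monoid monoid.one_closed by (metis group_hom.axioms(1))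

lemma mult_closed: "g \<in> carrier G \<Longrightarrow> h \<in> carrier G \<Longrightarrow> g \<otimes>\<^bsub>G\<^esub> h \<in> carrier G"
  using group_hom group.is_monoid monoid.m_closed by (metis group_hom.axioms(1))

lemma inv_mult_cancel: "g \<in> carrier G \<Longrightarrow> h \<in> carrier G \<Longrightarrow> h \<otimes>\<^bsub>G\<^esub> inv\<^bsub>G\<^esub> g \<otimes>\<^bsub>G\<^esub> g = h"
  using group.inv_solve_right' group_hom mult_closed inv_closed by (metis group_hom.axioms(1))

lemma act_in_space: "g \<in> carrier G \<Longrightarrow> x \<in> space M \<Longrightarrow> T g x \<in> space M"
  using element_image by blast

lemma act_inv_act: "g \<in> carrier G \<Longrightarrow> x \<in> space M \<Longrightarrow> T (inv\<^bsub>G\<^esub> g) (T g x) = x"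
  using orbit_sym_aux by blast

lemma act_act_inv: "g \<in> carrier G \<Longrightarrow> x \<in> space M \<Longrightarrow> T g (T (inv\<^bsub>G\<^esub> g) x) = x"
  using orbit_sym_aux[of "inv\<^bsub>G\<^esub> g" x] inv_closed group_hom
  by (metis group.inv_inv group_hom.axioms(1))

lemma measurable_act [measurable]: "g \<in> carrier G \<Longrightarrow> T g \<in> M \<rightarrow>\<^sub>M M"
  using preserving unfolding measure_preserving_def by blast

lemma distr_act: "g \<in> carrier G \<Longrightarrow> distr M M (T g) = M"
  using preserving unfolding measure_preserving_def by blast

lemma emeasure_act_vimage:
  "g \<in> carrier G \<Longrightarrow> A \<in> sets M \<Longrightarrow> emeasure M (T g -` A \<inter> space M) = emeasure M A"
  using distr_act emeasure_distr[OF measurable_act] by metis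

text \<open>Invariance of sets and subalgebras is phrased by images, measurability by preimages; the
  inverse group element translates between them.\<close>

lemma act_image_eq_vimage:
  assumes "g \<in> carrier G" "A \<subseteq> space M"
  shows "T g ` A = T (inv\<^bsub>G\<^esub> g) -` A \<inter> space M"
proof (intro Set.set_eqI iffI)
  fix x assume "x \<in> T g ` A"
  then show "x \<in> T (inv\<^bsub>G\<^esub> g) -` A \<inter> space M"
    using assms act_inv_act act_in_space by auto
next
  fix x assume "x \<in> T (inv\<^bsub>G\<^esub> g) -` A \<inter> space M"
  then show "x \<in> T g ` A"
    using assms act_act_inv by (intro image_eqI[of _ _ "T (inv\<^bsub>G\<^esub> g) x"]) auto
qed

lemma act_inv_image_eq_vimage:
  assumes "g \<in> carrier G" "A \<subseteq> space M"
  shows "T (inv\<^bsub>G\<^esub> g) ` A = T g -` A \<inter> space M"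
  using act_image_eq_vimage[OF inv_closed[OF assms(1)] assms(2)] group_hom assms(1)
  by (metis group.inv_inv group_hom.axioms(1))

lemma sets_act_image: "g \<in> carrier G \<Longrightarrow> A \<in> sets M \<Longrightarrow> T g ` A \<in> sets M"
  using act_image_eq_vimage sets.sets_into_space measurable_sets[OF measurable_act] inv_closed by metis

lemma AE_act: "g \<in> carrier G \<Longrightarrow> (AE x in M. P x) \<Longrightarrow> AE x in M. P (T g x)"
  using AE_distrD[OF measurable_act, of g P] distr_act by metis

lemma invariantI:
  assumes "A \<subseteq> space M" "\<And>g x. g \<in> carrier G \<Longrightarrow> x \<in> A \<Longrightarrow> T g x \<in> A"
  shows "\<forall>g\<in>carrier G. T g ` A = A"
proof (intro ballI equalityI)
  fix g assume g: "g \<in> carrier G"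
  then show "T g ` A \<subseteq> A" using assms by blast
  show "A \<subseteq> T g ` A"
  proof
    fix x assume "x \<in> A"
    then show "x \<in> T g ` A"
      using act_act_inv[OF g, of x] assms inv_closed[OF g] by (metis image_eqI subsetD)
  qed
qed

text \<open>The points whose orbit meets \<open>A\<close> form a strictly invariant set, measurable
  because the group is countable. It contains the preimage of \<open>A\<close> under the unit
  element, so it is not null.\<close>

lemma ergodic_orbit_meets:
  assumes erg: "ergodic G M T" and A: "A \<in> sets M" "emeasure M A > 0"
  shows "AE x in M. \<exists>g\<in>carrier G. T g x \<in> A"
proof -
  define U where "U = {x\<in>space M. \<exists>g\<in>carrier G. T g x \<in> A}"
  have "U = (\<Union>g\<in>carrier G. T g -` A \<inter> space M)" by (auto simp: U_def)
  also have "\<dots> \<in> sets M"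
    using countable_group A measurable_sets[OF measurable_act] by (intro sets.countable_UN') auto
  finally have U: "U \<in> sets M" .
  have "\<forall>g\<in>carrier G. T g ` U = U"
  proof (rule invariantI)
    fix g x assume g: "g \<in> carrier G" and "x \<in> U"
    then obtain h where h: "h \<in> carrier G" "T h x \<in> A" "x \<in> space M" by (auto simp: U_def)
    have "T (h \<otimes>\<^bsub>G\<^esub> inv\<^bsub>G\<^esub> g) (T g x) = T h x"
      using composition_rule[OF h(3) mult_closed[OF h(1) inv_closed[OF g]] g] inv_mult_cancel[OF g h(1)] by simp
    then show "T g x \<in> U"
      using h g mult_closed[OF h(1) inv_closed[OF g]] act_in_space unfolding U_def by force
  qed (auto simp: U_def)
  then have "emeasure M U = 0 \<or> emeasure M U = 1"
    using erg U unfolding ergodic_def by blast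
  moreover have "T \<one>\<^bsub>G\<^esub> -` A \<inter> space M \<subseteq> U" using one_closed by (auto simp: U_def)
  then have "emeasure M A \<le> emeasure M U"
    using emeasure_mono[OF _ U] emeasure_act_vimage[OF one_closed A(1)] by metis
  ultimately have "emeasure M U = 1" using A(2) by auto
  then have "AE x in M. x \<in> U" using U by (simp add: AE_in_set_eq_1 emeasure_eq_measure)
  then show ?thesis by eventually_elim (auto simp: U_def)
qed

text \<open>\<open>ergodic\<close> speaks of strictly invariant sets only. The points whose whole
  orbit lies in \<open>A\<close> form such a set, and it differs from \<open>A\<close> by a null set
  because a countable group yields only countably many exceptional sets.\<close>

lemma ergodic_AE_invariant_set:
  assumes erg: "ergodic G M T" and A: "A \<in> sets M"
    and inv: "\<And>g. g \<in> carrier G \<Longrightarrow> AE x in M. T g x \<in> A \<longleftrightarrow> x \<in> A"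
  shows "emeasure M A = 0 \<or> emeasure M A = 1"
proof -
  define U where "U = {x\<in>space M. \<forall>g\<in>carrier G. T g x \<in> A}"
  have "U = (\<Inter>g\<in>carrier G. T g -` A \<inter> space M)" using one_closed by (auto simp: U_def)
  also have "\<dots> \<in> sets M"
    using countable_group A measurable_sets[OF measurable_act] one_closed
    by (intro sets.countable_INT') auto
  finally have U: "U \<in> sets M" .
  have "\<forall>g\<in>carrier G. T g ` U = U"
  proof (rule invariantI)
    fix g x assume g: "g \<in> carrier G" and "x \<in> U"
    then have x: "x \<in> space M" "\<And>h. h \<in> carrier G \<Longrightarrow> T h x \<in> A" by (auto simp: U_def)
    have "T h (T g x) \<in> A" if "h \<in> carrier G" for h
      using composition_rule[OF x(1) that g] x(2)[OF mult_closed[OF that g]] by simp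
    then show "T g x \<in> U" using act_in_space[OF g x(1)] by (auto simp: U_def)
  qed (auto simp: U_def)
  then have "emeasure M U = 0 \<or> emeasure M U = 1"
    using erg U unfolding ergodic_def by blast
  moreover have "AE x in M. \<forall>g\<in>carrier G. T g x \<in> A \<longleftrightarrow> x \<in> A"
    using countable_group inv by (subst AE_ball_countable) auto
  then have "AE x in M. x \<in> U \<longleftrightarrow> x \<in> A"
    using AE_space by eventually_elim (use one_closed in \<open>auto simp: U_def\<close>)
  then have "emeasure M U = emeasure M A" using U A by (rule emeasure_eq_AE)
  ultimately show ?thesis by simp
qed

text \<open>The sets where \<open>f\<close> lies strictly below or strictly above its mean are null
  or of full measure; one of full measure would make the mean strictly smaller or larger than
  itself.\<close>

lemma ergodic_AE_invariant_const:
  fixes f :: "'a \<Rightarrow> real"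
  assumes erg: "ergodic G M T" and f: "integrable M f"
    and inv: "\<And>g. g \<in> carrier G \<Longrightarrow> AE x in M. f (T g x) = f x"
  shows "AE x in M. f x = (\<integral>x. f x \<partial>M)"
proof -
  let ?c = "\<integral>x. f x \<partial>M"
  have [measurable]: "f \<in> borel_measurable M" using f by auto
  have cst: "integrable M (\<lambda>x. ?c)" "(\<integral>x. ?c \<partial>M) = ?c" using prob_space by auto
  have "emeasure M {x\<in>space M. P (f x)} = 0 \<or> emeasure M {x\<in>space M. P (f x)} = 1"
    if [measurable]: "Measurable.pred borel P" for P
  proof (rule ergodic_AE_invariant_set[OF erg])
    fix g assume g: "g \<in> carrier G"
    show "AE x in M. T g x \<in> {x\<in>space M. P (f x)} \<longleftrightarrow> x \<in> {x\<in>space M. P (f x)}"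
      using inv[OF g] AE_space by eventually_elim (use act_in_space[OF g] in auto)
  qed measurable
  note dich = this
  have full: "AE x in M. P (f x)" if [measurable]: "Measurable.pred borel P" and "emeasure M {x\<in>space M. P (f x)} = 1" for P
  proof -
    have "prob {x\<in>space M. P (f x)} = 1" using that(2) by (simp add: emeasure_eq_measure)
    from AE_prob_1[OF this] show ?thesis by eventually_elim simp
  qed
  have "\<not> emeasure M {x\<in>space M. f x < ?c} = 1"
  proof
    assume "emeasure M {x\<in>space M. f x < ?c} = 1"
    then have ae: "AE x in M. f x < ?c" using full[of "\<lambda>t. t < ?c"] by simp
    have "?c < (\<integral>x. ?c \<partial>M)"
      by (rule integral_less_AE_space[OF f cst(1) ae]) (simp add: emeasure_space_1)
    then show False by (metis cst(2) less_irrefl)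
  qed
  then have 1: "emeasure M {x\<in>space M. f x < ?c} = 0" using dich[of "\<lambda>t. t < ?c"] by auto
  have "\<not> emeasure M {x\<in>space M. ?c < f x} = 1"
  proof
    assume "emeasure M {x\<in>space M. ?c < f x} = 1"
    then have ae: "AE x in M. ?c < f x" using full[of "\<lambda>t. ?c < t"] by simp
    have "(\<integral>x. ?c \<partial>M) < ?c"
      by (rule integral_less_AE_space[OF cst(1) f ae]) (simp add: emeasure_space_1)
    then show False by (metis cst(2) less_irrefl)
  qed
  then have 2: "emeasure M {x\<in>space M. ?c < f x} = 0" using dich[of "\<lambda>t. ?c < t"] by auto
  have "AE x in M. \<not> f x < ?c" using 1 by (subst AE_iff_measurable[OF _ refl]) auto
  moreover have "AE x in M. \<not> ?c < f x" using 2 by (subst AE_iff_measurable[OF _ refl]) auto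
  ultimately show ?thesis by eventually_elim auto
qed

lemma complete_invariant_generated:
  assumes "\<alpha> \<subseteq> sets M"
  shows "complete_invariant_subalgebra G M T (generated_subalgebra G M T \<alpha>)"
    and "\<alpha> \<subseteq> generated_subalgebra G M T \<alpha>"
proof -
  let ?F = "{\<A>. complete_invariant_subalgebra G M T \<A> \<and> \<alpha> \<subseteq> \<A>}"
  \<comment> \<open>The full algebra belongs to the family, so the intersection is over a nonempty
    family and stays inside \<open>sets M\<close>.\<close>
  have top: "sets M \<in> ?F"
    using assms sets_act_image unfolding complete_invariant_subalgebra_def
    by (auto simp: sets.sigma_algebra_axioms)
  have "sigma_algebra (space M) (\<Inter>?F)"
    unfolding sigma_algebra_iff2
  proof (intro conjI ballI allI impI)
    show "\<Inter>?F \<subseteq> Pow (space M)" using top sets.space_closed by blast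
    have F: "{} \<in> \<A>" "\<And>s. s \<in> \<A> \<Longrightarrow> space M - s \<in> \<A>"
      "\<And>A :: nat \<Rightarrow> _. range A \<subseteq> \<A> \<Longrightarrow> \<Union> (range A) \<in> \<A>" if "\<A> \<in> ?F" for \<A>
      using that unfolding complete_invariant_subalgebra_def sigma_algebra_iff2 by auto
    show "{} \<in> \<Inter>?F" using F(1) by (rule InterI)
    show "space M - s \<in> \<Inter>?F" if "s \<in> \<Inter>?F" for s
      by (rule InterI) (use that F(2) in blast)
    show "\<Union> (range A) \<in> \<Inter>?F" if "range A \<subseteq> \<Inter>?F" for A :: "nat \<Rightarrow> _"
      by (rule InterI) (use that F(3) in blast)
  qed
  moreover have "\<Inter>?F \<subseteq> sets M" using top by blast
  moreover have "B \<in> \<Inter>?F" if "A \<in> \<Inter>?F" "B \<in> sets M" "emeasure M (sym_diff A B) = 0" for A B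
    by (rule InterI) (use that in \<open>auto simp: complete_invariant_subalgebra_def\<close>)
  moreover have "T g ` A \<in> \<Inter>?F" if "A \<in> \<Inter>?F" "g \<in> carrier G" for A g
    by (rule InterI) (use that in \<open>auto simp: complete_invariant_subalgebra_def\<close>)
  ultimately show "complete_invariant_subalgebra G M T (generated_subalgebra G M T \<alpha>)"
    unfolding generated_subalgebra_def complete_invariant_subalgebra_def[of _ _ _ "\<Inter>?F"] by blast
  show "\<alpha> \<subseteq> generated_subalgebra G M T \<alpha>"
    unfolding generated_subalgebra_def by blast
qed

end

lemma generated_subalgebra_least:
  "complete_invariant_subalgebra G M T \<A> \<Longrightarrow> \<alpha> \<subseteq> \<A> \<Longrightarrow> generated_subalgebra G M T \<alpha> \<subseteq> \<A>"
  unfolding generated_subalgebra_def by blast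

section \<open>Disintegrations over a factor\<close>

text \<open>\<open>X\<close> and \<open>N\<close> have the same points: the action and
  \<open>p\<close> are measurable for the completion \<open>X\<close>, while the values of
  \<open>\<kappa>\<close> are measures on \<open>sets N\<close>.\<close>

locale disintegrated_extension =
  fixes G :: "('g, 'm) monoid_scheme" and X :: "'a measure" and T :: "'g \<Rightarrow> 'a \<Rightarrow> 'a"
    and Y :: "'b measure" and S :: "'g \<Rightarrow> 'b \<Rightarrow> 'b" and p :: "'a \<Rightarrow> 'b"
    and N :: "'a measure" and \<kappa> :: "'b \<Rightarrow> 'a measure"
  assumes factor: "factor_map G X T Y S p"
    and model: "borel_model N X"
    and disint: "disintegration N Y p \<kappa>"
begin

sublocale X: dynamical_system G X T using factor unfolding factor_map_def by blast
sublocale Y: dynamical_system G Y S using factor unfolding factor_map_def by blast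
sublocale N: prob_space N using model unfolding borel_model_def by blast

lemma X_eq: "X = completion N" using model unfolding borel_model_def by blast

lemma space_X: "space X = space N" by (simp add: X_eq)

lemma sets_N_X: "B \<in> sets N \<Longrightarrow> B \<in> sets X" by (simp add: X_eq)

lemma emeasure_X: "B \<in> sets N \<Longrightarrow> emeasure X B = emeasure N B" by (simp add: X_eq)

lemma AE_X_iff: "(AE x in X. P x) \<longleftrightarrow> (AE x in N. P x)" unfolding X_eq by (rule AE_completion_iff)

lemma measurable_X: "f \<in> N \<rightarrow>\<^sub>M K \<Longrightarrow> f \<in> X \<rightarrow>\<^sub>M K" unfolding X_eq by (rule measurable_completion)

lemma p_measurable [measurable]: "p \<in> X \<rightarrow>\<^sub>M Y"
  and distr_p: "distr X Y p = Y"
  using factor unfolding factor_map_def measure_preserving_def by auto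

lemma equivariant: "g \<in> carrier G \<Longrightarrow> AE x in X. p (T g x) = S g (p x)"
  using factor unfolding factor_map_def by auto

lemma AE_p: "(AE y in Y. P y) \<Longrightarrow> AE x in X. P (p x)"
  using AE_distrD[OF p_measurable, of P] distr_p by metis

lemma \<kappa>_measurable [measurable]: "\<kappa> \<in> Y \<rightarrow>\<^sub>M prob_algebra N"
  using disint unfolding disintegration_def by auto

lemma \<kappa>_subprob [measurable]: "\<kappa> \<in> Y \<rightarrow>\<^sub>M subprob_algebra N"
  using \<kappa>_measurable by (rule measurable_prob_algebraD)

lemma \<kappa>_prob: "y \<in> space Y \<Longrightarrow> prob_space (\<kappa> y)"
  and sets_\<kappa>: "y \<in> space Y \<Longrightarrow> sets (\<kappa> y) = sets N"
  using measurable_space[OF \<kappa>_measurable] by (auto simp: space_prob_algebra)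

lemma space_\<kappa>: "y \<in> space Y \<Longrightarrow> space (\<kappa> y) = space N"
  by (metis sets_\<kappa> sets_eq_imp_space_eq)

lemma emeasure_N: "B \<in> sets N \<Longrightarrow> emeasure N B = (\<integral>\<^sup>+y. emeasure (\<kappa> y) B \<partial>Y)"
proof -
  assume B: "B \<in> sets N"
  have "N = Y \<bind> \<kappa>" using disint unfolding disintegration_def by auto
  then show ?thesis using emeasure_bind[OF Y.not_empty \<kappa>_subprob B] by simp
qed

lemma AE_fibre: "AE y in Y. AE x in \<kappa> y. p x = y"
  using disint unfolding disintegration_def by auto

lemma \<kappa>_emeasure_measurable [measurable]: "B \<in> sets N \<Longrightarrow> (\<lambda>y. emeasure (\<kappa> y) B) \<in> borel_measurable Y"
  by measurable

lemma AE_\<kappa>_null: 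
  assumes "R \<in> null_sets N"
  shows "AE y in Y. emeasure (\<kappa> y) R = 0"
proof -
  have R: "R \<in> sets N" using assms by auto
  then have "(\<integral>\<^sup>+y. emeasure (\<kappa> y) R \<partial>Y) = 0" using emeasure_N[OF R] assms by auto
  then show ?thesis using R by (subst (asm) nn_integral_0_iff_AE) auto
qed

text \<open>\<open>P\<close> need not define a measurable set; a null set of \<open>N\<close>
  covering its failures is null for almost every conditional measure, because \<open>N\<close> is
  the integral of these.\<close>

lemma AE_\<kappa>:
  assumes "AE x in N. P x"
  shows "AE y in Y. AE x in \<kappa> y. P x"
proof -
  obtain R where R: "R \<in> null_sets N" "{x \<in> space N. \<not> P x} \<subseteq> R"
    using assms unfolding eventually_ae_filter by auto
  show ?thesis using AE_\<kappa>_null[OF R(1)] AE_space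
  proof eventually_elim
    case (elim y)
    have "R \<in> null_sets (\<kappa> y)" using elim(1) R(1) sets_\<kappa>[OF elim(2)] by (auto simp: null_sets_def)
    then show ?case using R(2) space_\<kappa>[OF elim(2)] by (intro AE_I') auto
  qed
qed

text \<open>The preimage of \<open>C\<close> is replaced by a set \<open>C0\<close> of
  \<open>N\<close> up to a null set. As \<open>\<kappa> y\<close> lives on the fibre over
  \<open>y\<close>, almost every \<open>\<kappa> y\<close> sees \<open>C0\<close> as everything or
  nothing, according to whether \<open>y\<close> is in \<open>C\<close>.\<close>

lemma emeasure_fibre_inter:
  assumes C: "C \<in> sets Y" and B: "B \<in> sets N"
  shows "emeasure X (p -` C \<inter> B) = (\<integral>\<^sup>+y\<in>C. emeasure (\<kappa> y) B \<partial>Y)"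
proof -
  have "p -` C \<inter> space X \<in> sets X" using C by measurable
  then obtain C0 Q Q' where Q: "p -` C \<inter> space X = C0 \<union> Q" "Q \<subseteq> Q'" "Q' \<in> null_sets N" "C0 \<in> sets N"
    unfolding X_eq using sets_completionE[of _ N] by metis
  have aeN: "AE x in N. p x \<in> C \<longleftrightarrow> x \<in> C0"
    using AE_not_in[OF Q(3)] AE_space
  proof eventually_elim
    case (elim x)
    then have "x \<in> p -` C \<inter> space X \<longleftrightarrow> x \<in> C0" using Q by auto
    then show ?case using elim space_X by auto
  qed
  have pCB: "p -` C \<inter> B = (p -` C \<inter> space X) \<inter> B"
    using sets.sets_into_space[OF B] space_X by auto
  have "p -` C \<inter> B \<in> sets X" unfolding pCB using C sets_N_X[OF B] by measurable
  then have "emeasure X (p -` C \<inter> B) = emeasure X (C0 \<inter> B)"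
    using aeN sets_N_X[OF Q(4)] sets_N_X[OF B] unfolding AE_X_iff[symmetric]
    by (intro emeasure_eq_AE) auto
  also have "\<dots> = emeasure N (C0 \<inter> B)" using Q B by (intro emeasure_X) auto
  also have "\<dots> = (\<integral>\<^sup>+y. emeasure (\<kappa> y) (C0 \<inter> B) \<partial>Y)" using Q B by (intro emeasure_N) auto
  also have "\<dots> = (\<integral>\<^sup>+y\<in>C. emeasure (\<kappa> y) B \<partial>Y)"
  proof (rule nn_integral_cong_AE)
    show "AE y in Y. emeasure (\<kappa> y) (C0 \<inter> B) = emeasure (\<kappa> y) B * indicator C y"
      using AE_\<kappa>[OF aeN] AE_fibre AE_space
    proof eventually_elim
      case (elim y)
      have ae: "AE x in \<kappa> y. x \<in> C0 \<inter> B \<longleftrightarrow> x \<in> (if y \<in> C then B else {})"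
        using elim(1,2) by eventually_elim auto
      have "emeasure (\<kappa> y) (C0 \<inter> B) = emeasure (\<kappa> y) (if y \<in> C then B else {})"
        by (rule emeasure_eq_AE[OF ae]) (use Q B sets_\<kappa>[OF elim(3)] in auto)
      then show ?case by auto
    qed
  qed
  finally show ?thesis .
qed

lemma ident_measurable: "(\<lambda>x. x) \<in> X \<rightarrow>\<^sub>M N"
  by (intro measurable_X) simp

lemma graph_measurable [measurable]: "(\<lambda>x. (p x, x)) \<in> X \<rightarrow>\<^sub>M Y \<Otimes>\<^sub>M N"
  by (intro measurable_Pair p_measurable ident_measurable)

text \<open>The kernel \<open>K\<close> places the conditional measure at \<open>y\<close> on the
  slice over \<open>y\<close>; its integral over \<open>Y\<close> and the law of the graph map agree
  on rectangles by \<open>emeasure_fibre_inter\<close>, hence everywhere. The base point is a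
  separate variable because later integrands involve the conditional measures of a second extension
  at that point.\<close>

lemma nn_integral_fibre:
  assumes h[measurable]: "h \<in> borel_measurable (Y \<Otimes>\<^sub>M N)"
  shows "(\<integral>\<^sup>+x. h (p x, x) \<partial>X) = (\<integral>\<^sup>+y. \<integral>\<^sup>+x. h (y, x) \<partial>\<kappa> y \<partial>Y)"
proof -
  define K where "K y = return Y y \<Otimes>\<^sub>M \<kappa> y" for y
  have K: "K \<in> Y \<rightarrow>\<^sub>M subprob_algebra (Y \<Otimes>\<^sub>M N)"
    unfolding K_def by (intro measurable_prob_algebraD measurable_pair_prob) auto
  have K_rect: "emeasure (K y) (C \<times> B) = emeasure (\<kappa> y) B * indicator C y"
    if "y \<in> space Y" "C \<in> sets Y" "B \<in> sets N" for y C B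
  proof -
    interpret \<kappa>: prob_space "\<kappa> y" using \<kappa>_prob that by simp
    have "B \<in> sets (\<kappa> y)" using that(3) sets_\<kappa>[OF that(1)] by simp
    then have "emeasure (K y) (C \<times> B) = emeasure (return Y y) C * emeasure (\<kappa> y) B"
      unfolding K_def using that(2) by (intro \<kappa>.emeasure_pair_measure_Times) simp_all
    then show ?thesis using that(2) by (simp add: mult.commute)
  qed
  have "distr X (Y \<Otimes>\<^sub>M N) (\<lambda>x. (p x, x)) = Y \<bind> K"
  proof (rule measure_eqI_generator_eq[OF Int_stable_pair_measure_generator[of Y N]])
    show "{a \<times> b |a b. a \<in> sets Y \<and> b \<in> sets N} \<subseteq> Pow (space Y \<times> space N)"
      by (auto dest!: sets.sets_into_space)
    show "sets (distr X (Y \<Otimes>\<^sub>M N) (\<lambda>x. (p x, x))) = sigma_sets (space Y \<times> space N) {a \<times> b |a b. a \<in> sets Y \<and> b \<in> sets N}"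
      by (simp add: sets_pair_measure)
    show "sets (Y \<bind> K) = sigma_sets (space Y \<times> space N) {a \<times> b |a b. a \<in> sets Y \<and> b \<in> sets N}"
      using sets_bind[OF sets_kernel[OF K] Y.not_empty] by (simp add: sets_pair_measure)
    show "range (\<lambda>i::nat. space Y \<times> space N) \<subseteq> {a \<times> b |a b. a \<in> sets Y \<and> b \<in> sets N}" by auto
    show "(\<Union>i::nat. space Y \<times> space N) = space Y \<times> space N" by auto
    show "emeasure (distr X (Y \<Otimes>\<^sub>M N) (\<lambda>x. (p x, x))) (space Y \<times> space N) \<noteq> \<infinity>"
      by (subst emeasure_distr) (auto simp: X.emeasure_eq_measure intro: sets.top)
    fix Z assume "Z \<in> {a \<times> b |a b. a \<in> sets Y \<and> b \<in> sets N}"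
    then obtain C B where Z: "Z = C \<times> B" and C: "C \<in> sets Y" and B: "B \<in> sets N" by auto
    have "(\<lambda>x. (p x, x)) -` Z \<inter> space X = p -` C \<inter> B"
      using Z sets.sets_into_space[OF B] space_X by auto
    then have "emeasure (distr X (Y \<Otimes>\<^sub>M N) (\<lambda>x. (p x, x))) Z = (\<integral>\<^sup>+y\<in>C. emeasure (\<kappa> y) B \<partial>Y)"
      using Z C B by (subst emeasure_distr) (auto simp: emeasure_fibre_inter)
    also have "\<dots> = (\<integral>\<^sup>+y. emeasure (K y) Z \<partial>Y)"
      unfolding Z using C B by (intro nn_integral_cong) (simp add: K_rect)
    also have "\<dots> = emeasure (Y \<bind> K) Z"
      using Z C B by (intro emeasure_bind[symmetric, OF Y.not_empty K]) auto
    finally show "emeasure (distr X (Y \<Otimes>\<^sub>M N) (\<lambda>x. (p x, x))) Z = emeasure (Y \<bind> K) Z" .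
  qed
  then have "(\<integral>\<^sup>+x. h (p x, x) \<partial>X) = (\<integral>\<^sup>+z. h z \<partial>(Y \<bind> K))"
    using nn_integral_distr[OF graph_measurable, of h] h by (metis measurable_distr_eq1)
  also have "\<dots> = (\<integral>\<^sup>+y. \<integral>\<^sup>+z. h z \<partial>K y \<partial>Y)" by (rule nn_integral_bind[OF h K])
  also have "\<dots> = (\<integral>\<^sup>+y. \<integral>\<^sup>+x. h (y, x) \<partial>\<kappa> y \<partial>Y)"
  proof (rule nn_integral_cong)
    fix y assume y: "y \<in> space Y"
    interpret \<kappa>: prob_space "\<kappa> y" using \<kappa>_prob y by simp
    have "sets (Y \<Otimes>\<^sub>M \<kappa> y) = sets (Y \<Otimes>\<^sub>M N)"
      using sets_\<kappa>[OF y] by (intro sets_pair_measure_cong) simp_all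
    then have hy: "h \<in> borel_measurable (Y \<Otimes>\<^sub>M \<kappa> y)"
      using h measurable_cong_sets by blast
    have m: "(\<lambda>y'. \<integral>\<^sup>+x. h (y', x) \<partial>\<kappa> y) \<in> borel_measurable Y"
      using hy by (rule \<kappa>.borel_measurable_nn_integral_fst)
    have "sets (return Y y \<Otimes>\<^sub>M \<kappa> y) = sets (Y \<Otimes>\<^sub>M \<kappa> y)"
      by (intro sets_pair_measure_cong) simp_all
    then have hr: "h \<in> borel_measurable (return Y y \<Otimes>\<^sub>M \<kappa> y)"
      using hy measurable_cong_sets by blast
    have "(\<integral>\<^sup>+z. h z \<partial>K y) = (\<integral>\<^sup>+y'. \<integral>\<^sup>+x. h (y', x) \<partial>\<kappa> y \<partial>return Y y)"
      unfolding K_def using hr by (rule \<kappa>.nn_integral_fst[symmetric])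
    also have "\<dots> = (\<integral>\<^sup>+x. h (y, x) \<partial>\<kappa> y)" using y m by (rule nn_integral_return)
    finally show "(\<integral>\<^sup>+z. h z \<partial>K y) = (\<integral>\<^sup>+x. h (y, x) \<partial>\<kappa> y)" .
  qed
  finally show ?thesis .
qed

text \<open>Essential uniqueness of disintegrations: for a fixed \<open>B\<close>, both kernels have
  the same integrals over all sets of \<open>Y\<close>, since \<open>T g\<close> preserves the
  measure and covers \<open>S g\<close>. The exceptional set depends on \<open>B\<close>, so only
  the members of a countable algebra are tested, and these determine the measures. The version
  \<open>t\<close> is used because \<open>T g\<close> itself need not be measurable for
  \<open>N\<close>.\<close>

lemma equivariant_kernel:
  assumes g: "g \<in> carrier G"
  obtains t where "t \<in> N \<rightarrow>\<^sub>M N" "AE x in X. t x = T g x" "AE y in Y. distr (\<kappa> y) N t = \<kappa> (S g y)"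
proof -
  have "standard_borel N" using model unfolding borel_model_def by blast
  then obtain \<V> where V: "countable \<V>" "algebra (space N) \<V>" "sets N = sigma_sets (space N) \<V>"
    by (rule standard_borel_countable_algebra)
  interpret V: algebra "space N" \<V> by fact
  have "T g \<in> completion N \<rightarrow>\<^sub>M N"
    using measurable_compose[OF X.measurable_act[OF g] ident_measurable] by (simp only: X_eq)
  then obtain t where t: "t \<in> N \<rightarrow>\<^sub>M N" and tT: "AE x in N. t x = T g x"
    by (rule completion_borel_version[OF _ V(3,1) V.space_closed])
  have "AE y in Y. emeasure (\<kappa> y) (t -` B \<inter> space N) = emeasure (\<kappa> (S g y)) B" if B: "B \<in> sets N" for B
  proof -
    let ?f = "\<lambda>y. emeasure (\<kappa> y) (t -` B \<inter> space N)" and ?h = "\<lambda>y. emeasure (\<kappa> (S g y)) B"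
    have tB: "t -` B \<inter> space N \<in> sets N" using measurable_sets[OF t B] .
    have f: "?f \<in> borel_measurable Y" using \<kappa>_emeasure_measurable[OF tB] .
    have h: "?h \<in> borel_measurable Y"
      using measurable_compose[OF Y.measurable_act[OF g] \<kappa>_emeasure_measurable[OF B]] .
    have "density Y ?f = density Y ?h"
    proof (rule measure_eqI)
      fix C assume "C \<in> sets (density Y ?f)"
      then have C: "C \<in> sets Y" by simp
      \<comment> \<open>For almost every \<open>x\<close>, \<open>p x\<close> lies in
        \<open>C\<close> iff \<open>p (T g x)\<close> lies in the image of \<open>C\<close>; this
        turns an integral over \<open>C\<close> into one over the image.\<close>
      let ?C = "S g ` C"
      have C': "?C \<in> sets Y" using Y.sets_act_image[OF g C] .
      have SC: "S g y \<in> ?C \<longleftrightarrow> y \<in> C" if "y \<in> space Y" for y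
        using Y.inj_prop[OF g] sets.sets_into_space[OF C] that by (auto simp: inj_on_def)
      have pB: "p -` ?C \<inter> B = (p -` ?C \<inter> space X) \<inter> B"
        using sets.sets_into_space[OF B] space_X by auto
      have pB': "p -` ?C \<inter> B \<in> sets X" 
        unfolding pB by (rule sets.Int[OF measurable_sets[OF p_measurable C'] sets_N_X[OF B]])
      have pC: "p -` C \<inter> (t -` B \<inter> space N) = (p -` C \<inter> space X) \<inter> (t -` B \<inter> space N)"
        using space_X by auto
      have pC': "p -` C \<inter> (t -` B \<inter> space N) \<in> sets X"
        unfolding pC by (rule sets.Int[OF measurable_sets[OF p_measurable C] sets_N_X[OF tB]])
      have "emeasure (density Y ?f) C = (\<integral>\<^sup>+y\<in>C. ?f y \<partial>Y)" by (rule emeasure_density[OF f C])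
      also have "\<dots> = emeasure X (p -` C \<inter> (t -` B \<inter> space N))"
        using emeasure_fibre_inter[OF C tB] by simp
      also have "\<dots> = emeasure X (T g -` (p -` ?C \<inter> B) \<inter> space X)"
      proof (rule emeasure_eq_AE)
        show "AE x in X. x \<in> p -` C \<inter> (t -` B \<inter> space N) \<longleftrightarrow> x \<in> T g -` (p -` ?C \<inter> B) \<inter> space X"
          using tT[folded AE_X_iff] equivariant[OF g] AE_space
          by eventually_elim (use SC measurable_space[OF p_measurable] space_X in auto)
        show "T g -` (p -` ?C \<inter> B) \<inter> space X \<in> sets X"
          using measurable_sets[OF X.measurable_act[OF g] pB'] .
      qed (rule pC')
      also have "\<dots> = emeasure X (p -` ?C \<inter> B)" using X.emeasure_act_vimage[OF g pB'] .
      also have "\<dots> = (\<integral>\<^sup>+y\<in>?C. emeasure (\<kappa> y) B \<partial>Y)" by (rule emeasure_fibre_inter[OF C' B])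
      also have "\<dots> = (\<integral>\<^sup>+y\<in>?C. emeasure (\<kappa> y) B \<partial>distr Y Y (S g))" using Y.distr_act[OF g] by simp
      also have "\<dots> = (\<integral>\<^sup>+y. emeasure (\<kappa> (S g y)) B * indicator ?C (S g y) \<partial>Y)"
        by (rule nn_integral_distr[OF Y.measurable_act[OF g]])
          (simp only: measurable_distr_eq1, intro borel_measurable_times_ennreal \<kappa>_emeasure_measurable[OF B] borel_measurable_indicator C')
      also have "\<dots> = (\<integral>\<^sup>+y\<in>C. ?h y \<partial>Y)"
        by (intro nn_integral_cong) (simp add: indicator_def SC)
      also have "\<dots> = emeasure (density Y ?h) C" by (rule emeasure_density[OF h C, symmetric])
      finally show "emeasure (density Y ?f) C = emeasure (density Y ?h) C" .
    qed simp
    then show ?thesis using Y.density_unique_iff[OF f h] by simp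
  qed
  then have "AE y in Y. \<forall>B\<in>\<V>. emeasure (\<kappa> y) (t -` B \<inter> space N) = emeasure (\<kappa> (S g y)) B"
    using V(1,3) by (subst AE_ball_countable) auto
  then have "AE y in Y. distr (\<kappa> y) N t = \<kappa> (S g y)"
    using AE_space
  proof eventually_elim
    case (elim y)
    note y' = Y.act_in_space[OF g elim(2)]
    interpret \<kappa>: prob_space "\<kappa> y" using \<kappa>_prob elim by simp
    have t': "t \<in> \<kappa> y \<rightarrow>\<^sub>M N" using t sets_\<kappa>[OF elim(2)] measurable_cong_sets by blast
    have em: "emeasure (distr (\<kappa> y) N t) B = emeasure (\<kappa> y) (t -` B \<inter> space N)" if "B \<in> sets N" for B
      using emeasure_distr[OF t' that] space_\<kappa>[OF elim(2)] by simp
    show ?case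
    proof (rule measure_eqI_generator_eq[of \<V> "space N" _ _ "\<lambda>i. space N"])
      show "Int_stable \<V>" by (auto simp: Int_stable_def)
      show "\<V> \<subseteq> Pow (space N)" by (rule V.space_closed)
      show "sets (distr (\<kappa> y) N t) = sigma_sets (space N) \<V>" using V(3) by simp
      show "sets (\<kappa> (S g y)) = sigma_sets (space N) \<V>" using V(3) sets_\<kappa>[OF y'] by simp
      show "emeasure (distr (\<kappa> y) N t) B = emeasure (\<kappa> (S g y)) B" if "B \<in> \<V>" for B
        using elim(1) that V(3) by (subst em) auto
      show "range (\<lambda>i::nat. space N) \<subseteq> \<V>" using V.top by blast
      show "(\<Union>i::nat. space N) = space N" by simp
      show "emeasure (distr (\<kappa> y) N t) (space N) \<noteq> \<infinity>" by (simp add: em \<kappa>.emeasure_eq_measure)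
    qed
  qed
  with t tT show ?thesis using that unfolding AE_X_iff by blast
qed

end

text \<open>A set of positive measure has a subset of intermediate measure, and this subset or its
  relative complement has at most half the measure; this is iterated.\<close>

lemma (in prob_space) nonatomic_small_subset:
  assumes na: "nonatomic M" and W: "W \<in> sets M" "prob W > 0" and "\<eta> > 0"
  obtains B where "B \<in> sets M" "B \<subseteq> W" "0 < prob B" "prob B < \<eta>"
proof -
  have half: "\<exists>B\<in>sets M. B \<subseteq> A \<and> 0 < prob B \<and> prob B \<le> prob A / 2" if A: "A \<in> sets M" "0 < prob A" for A
  proof -
    have "\<exists>B\<in>sets M. B \<subseteq> A \<and> prob B \<noteq> 0 \<and> prob B \<noteq> prob A"
      using na A unfolding nonatomic_def by (force simp: emeasure_eq_measure)
    then obtain B where B: "B \<in> sets M" "B \<subseteq> A" "prob B \<noteq> 0" "prob B \<noteq> prob A" by blast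
    have "prob (A - B) = prob A - prob B" using A B by (intro finite_measure_Diff)
    moreover have "prob B \<le> prob A" using A B by (intro finite_measure_mono)
    moreover have "0 < prob B" using B(3) by (simp add: less_le)
    ultimately show ?thesis
      using A B by (cases "prob B \<le> prob A / 2") (auto intro: bexI[of _ B] bexI[of _ "A - B"])
  qed
  have "\<exists>B\<in>sets M. B \<subseteq> W \<and> 0 < prob B \<and> prob B \<le> prob W / 2 ^ n" for n
  proof (induction n)
    case 0
    then show ?case using W by auto
  next
    case (Suc n)
    then obtain B where B: "B \<in> sets M" "B \<subseteq> W" "0 < prob B" "prob B \<le> prob W / 2 ^ n" by blast
    obtain B' where B': "B' \<in> sets M" "B' \<subseteq> B" "0 < prob B'" "prob B' \<le> prob B / 2"
      using half[OF B(1,3)] by blast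
    then have "prob B' \<le> (prob W / 2 ^ n) / 2"
      using order_trans[OF B'(4) divide_right_mono[OF B(4), of 2]] by simp
    then have "prob B' \<le> prob W / 2 ^ Suc n" by (simp add: mult.commute)
    then show ?case using B B' by blast
  qed
  note small = this
  obtain n where "(1/2::real) ^ n < \<eta>"
    using real_arch_pow_inv[OF \<open>\<eta> > 0\<close>, of "1/2"] by auto
  moreover have "prob W / 2 ^ n \<le> (1/2) ^ n"
    unfolding power_one_over by (intro divide_right_mono) simp_all
  ultimately have n: "prob W / 2 ^ n < \<eta>" by linarith
  obtain B where B: "B \<in> sets M" "B \<subseteq> W" "0 < prob B" "prob B \<le> prob W / 2 ^ n"
    using small[of n] by blast
  show ?thesis using B(1-3) le_less_trans[OF B(4) n] by (rule that)
qed

section \<open>Sections of an invariant set\<close>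

locale extension_pair =
  E1: disintegrated_extension G X T Y S p N \<kappa> + E2: disintegrated_extension G X' T' Y S p' N' \<kappa>'
  for G :: "('g, 'm) monoid_scheme" and X :: "'a measure" and T and Y :: "'b measure" and S and p and N and \<kappa>
    and X' :: "'c measure" and T' and p' and N' and \<kappa>'
begin

lemma section_sets: "R \<in> sets (N \<Otimes>\<^sub>M N') \<Longrightarrow> Pair x -` R \<in> sets N'"
  by (rule sets_Pair1)

text \<open>The base point and \<open>x\<close> are decoupled so that
  \<open>nn_integral_fibre\<close> applies; setting the base point to \<open>p x\<close> then gives
  measurability for \<open>X\<close>.\<close>

lemma section_measurable:
  assumes R: "R \<in> sets (N \<Otimes>\<^sub>M N')"
  shows "(\<lambda>z. emeasure (\<kappa>' (fst z)) (Pair (snd z) -` R)) \<in> borel_measurable (Y \<Otimes>\<^sub>M N)"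
proof (rule emeasure_measurable_subprob_algebra2)
  have "(SIGMA z:space (Y \<Otimes>\<^sub>M N). Pair (snd z) -` R)
    = (\<lambda>w. (snd (fst w), snd w)) -` R \<inter> space ((Y \<Otimes>\<^sub>M N) \<Otimes>\<^sub>M N')"
    using sets.sets_into_space[OF R] by (auto simp: space_pair_measure)
  also have "\<dots> \<in> sets ((Y \<Otimes>\<^sub>M N) \<Otimes>\<^sub>M N')"
    using R by (rule measurable_sets[rotated]) measurable
  finally show "(SIGMA z:space (Y \<Otimes>\<^sub>M N). Pair (snd z) -` R) \<in> sets ((Y \<Otimes>\<^sub>M N) \<Otimes>\<^sub>M N')" .
  show "(\<lambda>z. \<kappa>' (fst z)) \<in> Y \<Otimes>\<^sub>M N \<rightarrow>\<^sub>M subprob_algebra N'"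
    using measurable_compose[OF measurable_fst E2.\<kappa>_subprob] .
qed

lemma measure_section_measurable:
  assumes R: "R \<in> sets (N \<Otimes>\<^sub>M N')"
  shows "(\<lambda>x. measure (\<kappa>' (p x)) (Pair x -` R)) \<in> borel_measurable X"
  using measurable_compose[OF E1.graph_measurable section_measurable[OF R]]
  unfolding measure_def by simp

text \<open>Tonelli in each fibre product. The set \<open>C\<close> stays in the formula so that
  sections can be tested against all sets of the factor.\<close>

lemma section_integral:
  assumes R: "R \<in> sets (N \<Otimes>\<^sub>M N')" and C: "C \<in> sets Y"
  shows "(\<integral>\<^sup>+x. emeasure (\<kappa>' (p x)) (Pair x -` R) * indicator C (p x) \<partial>X)
    = (\<integral>\<^sup>+y\<in>C. emeasure (\<kappa> y \<Otimes>\<^sub>M \<kappa>' y) R \<partial>Y)"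
proof -
  let ?h = "\<lambda>z. emeasure (\<kappa>' (fst z)) (Pair (snd z) -` R) * indicator C (fst z)"
  have h: "?h \<in> borel_measurable (Y \<Otimes>\<^sub>M N)"
    using section_measurable[OF R] measurable_compose[OF measurable_fst borel_measurable_indicator[OF C]]
    by (rule borel_measurable_times_ennreal)
  have "(\<integral>\<^sup>+x. emeasure (\<kappa>' (p x)) (Pair x -` R) * indicator C (p x) \<partial>X)
    = (\<integral>\<^sup>+y. \<integral>\<^sup>+x. emeasure (\<kappa>' y) (Pair x -` R) * indicator C y \<partial>\<kappa> y \<partial>Y)"
    using E1.nn_integral_fibre[OF h] by simp
  also have "\<dots> = (\<integral>\<^sup>+y\<in>C. emeasure (\<kappa> y \<Otimes>\<^sub>M \<kappa>' y) R \<partial>Y)"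
  proof (rule nn_integral_cong)
    fix y assume y: "y \<in> space Y"
    interpret \<kappa>': prob_space "\<kappa>' y" using E2.\<kappa>_prob[OF y] .
    have "sets (\<kappa> y \<Otimes>\<^sub>M \<kappa>' y) = sets (N \<Otimes>\<^sub>M N')"
      using y E1.sets_\<kappa> E2.sets_\<kappa> by (intro sets_pair_measure_cong)
    then have R': "R \<in> sets (\<kappa> y \<Otimes>\<^sub>M \<kappa>' y)" using R by simp
    show "(\<integral>\<^sup>+x. emeasure (\<kappa>' y) (Pair x -` R) * indicator C y \<partial>\<kappa> y)
        = emeasure (\<kappa> y \<Otimes>\<^sub>M \<kappa>' y) R * indicator C y"
      by (simp add: \<kappa>'.emeasure_pair_measure_alt[OF R'] indicator_def)
  qed
  finally show ?thesis .
qed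

lemma AE_section:
  assumes R: "R \<in> sets (N \<Otimes>\<^sub>M N')" and null: "(\<integral>\<^sup>+y. emeasure (\<kappa> y \<Otimes>\<^sub>M \<kappa>' y) R \<partial>Y) = 0"
  shows "AE x in X. AE x' in \<kappa>' (p x). (x, x') \<notin> R"
proof -
  have m: "(\<lambda>x. emeasure (\<kappa>' (p x)) (Pair x -` R)) \<in> borel_measurable X"
    using measurable_compose[OF E1.graph_measurable section_measurable[OF R]] by simp
  have "(\<integral>\<^sup>+x. emeasure (\<kappa>' (p x)) (Pair x -` R) \<partial>X)
      = (\<integral>\<^sup>+x. emeasure (\<kappa>' (p x)) (Pair x -` R) * indicator (space Y) (p x) \<partial>X)"
    by (intro nn_integral_cong) (simp add: measurable_space[OF E1.p_measurable])
  also have "\<dots> = (\<integral>\<^sup>+y. emeasure (\<kappa> y \<Otimes>\<^sub>M \<kappa>' y) R \<partial>Y)"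
    unfolding section_integral[OF R sets.top] by (intro nn_integral_cong) simp
  finally have "AE x in X. emeasure (\<kappa>' (p x)) (Pair x -` R) = 0"
    using null m by (simp add: nn_integral_0_iff_AE)
  then show ?thesis
    using AE_space
  proof eventually_elim
    case (elim x)
    then have "Pair x -` R \<in> null_sets (\<kappa>' (p x))"
      using section_sets[OF R] E2.sets_\<kappa>[OF measurable_space[OF E1.p_measurable]] by (auto simp: null_sets_def)
    from AE_not_in[OF this] show ?case by eventually_elim auto
  qed
qed

text \<open>Makes every result about sections over \<open>X\<close> available for sections over
  \<open>X'\<close>; the final argument integrates in both directions.\<close>

lemma swapped: "extension_pair G X' T' Y S p' N' \<kappa>' X T p N \<kappa>"
  by unfold_locales

lemma swap_sets: "R \<in> sets (N \<Otimes>\<^sub>M N') \<Longrightarrow> prod.swap -` R \<inter> space (N' \<Otimes>\<^sub>M N) \<in> sets (N' \<Otimes>\<^sub>M N)"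
  by (rule measurable_sets[of _ _ "N \<Otimes>\<^sub>M N'"]) (simp_all add: measurable_pair_swap' prod.swap_def[abs_def] measurable_Pair)

lemma emeasure_swap:
  assumes R: "R \<in> sets (N \<Otimes>\<^sub>M N')" and y: "y \<in> space Y"
  shows "emeasure (\<kappa>' y \<Otimes>\<^sub>M \<kappa> y) (prod.swap -` R \<inter> space (N' \<Otimes>\<^sub>M N)) = emeasure (\<kappa> y \<Otimes>\<^sub>M \<kappa>' y) R"
proof -
  interpret \<kappa>: prob_space "\<kappa> y" using E1.\<kappa>_prob[OF y] .
  interpret \<kappa>': prob_space "\<kappa>' y" using E2.\<kappa>_prob[OF y] .
  interpret pair_sigma_finite "\<kappa> y" "\<kappa>' y" ..
  have s: "sets (\<kappa> y \<Otimes>\<^sub>M \<kappa>' y) = sets (N \<Otimes>\<^sub>M N')"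
    using y E1.sets_\<kappa> E2.sets_\<kappa> by (intro sets_pair_measure_cong)
  have sp: "space (\<kappa>' y \<Otimes>\<^sub>M \<kappa> y) = space (N' \<Otimes>\<^sub>M N)"
    using y E1.space_\<kappa> E2.space_\<kappa> by (simp add: space_pair_measure)
  have "emeasure (\<kappa> y \<Otimes>\<^sub>M \<kappa>' y) R = emeasure (distr (\<kappa>' y \<Otimes>\<^sub>M \<kappa> y) (\<kappa> y \<Otimes>\<^sub>M \<kappa>' y) (\<lambda>(x, y). (y, x))) R"
    using distr_pair_swap by simp
  also have "\<dots> = emeasure (\<kappa>' y \<Otimes>\<^sub>M \<kappa> y) ((\<lambda>(x, y). (y, x)) -` R \<inter> space (N' \<Otimes>\<^sub>M N))"
    using R s by (subst emeasure_distr) (auto simp: sp)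
  also have "(\<lambda>(x, y). (y, x)) -` R = prod.swap -` R" by auto
  finally show ?thesis by simp
qed

end

text \<open>Two sets are carried along: \<open>A\<close> is invariant at every point but, coming
  from a completed joining, may have nonmeasurable sections; \<open>A0\<close> has measurable
  sections but is invariant only almost everywhere.\<close>

locale invariant_pair = extension_pair G X T Y S p N \<kappa> X' T' p' N' \<kappa>'
  for G :: "('g, 'm) monoid_scheme" and X :: "'a measure" and T and Y :: "'b measure" and S and p and N and \<kappa>
    and X' :: "'c measure" and T' and p' and N' and \<kappa>' +
  fixes A A0 :: "('a \<times> 'c) set"
  assumes A0: "A0 \<in> sets (N \<Otimes>\<^sub>M N')"
    and inv: "g \<in> carrier G \<Longrightarrow> x \<in> space X \<Longrightarrow> x' \<in> space X' \<Longrightarrow> (T g x, T' g x') \<in> A \<longleftrightarrow> (x, x') \<in> A"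
    and version: "AE x in X. AE x' in \<kappa>' (p x). (x, x') \<in> A \<longleftrightarrow> (x, x') \<in> A0"
begin

definition sec :: "'c set \<Rightarrow> 'a \<Rightarrow> real" where
  "sec B x = measure (\<kappa>' (p x)) (Pair x -` A0 \<inter> B)"

text \<open>The set \<open>E\<close> does not depend on \<open>x\<close>. Comparing each section
  with such a reference replaces the distance between two sections over the same fibre, which the
  two gaps bound by the triangle inequality.\<close>

definition gap :: "'c set \<Rightarrow> 'a \<Rightarrow> real" where
  "gap E x = measure (\<kappa>' (p x)) (sym_diff (Pair x -` A0) E)"

lemma fibre_facts:
  assumes "x \<in> space X"
  shows "prob_space (\<kappa>' (p x))" "sets (\<kappa>' (p x)) = sets N'" "space (\<kappa>' (p x)) = space N'"
    "Pair x -` A0 \<in> sets N'"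
  using assms measurable_space[OF E1.p_measurable] E2.\<kappa>_prob E2.sets_\<kappa> E2.space_\<kappa> section_sets[OF A0] by auto

lemma sec_measurable:
  assumes B: "B \<in> sets N'"
  shows "sec B \<in> borel_measurable X"
proof -
  have R: "A0 \<inter> (space N \<times> B) \<in> sets (N \<Otimes>\<^sub>M N')" using A0 B by auto
  have "sec B x = measure (\<kappa>' (p x)) (Pair x -` (A0 \<inter> (space N \<times> B)))" if "x \<in> space X" for x
    using that E1.space_X unfolding sec_def by (auto intro!: arg_cong[where f = "measure _"])
  then show ?thesis
    using measure_section_measurable[OF R] by (simp cong: measurable_cong)
qed

text \<open>Through this formula any subalgebra that measures the functions \<open>sec B\<close> and
  the fibre measures also contains the sets where the gap is small.\<close>

lemma gap_eq:
  assumes x: "x \<in> space X" and E: "E \<in> sets N'"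
  shows "gap E x = measure (\<kappa>' (p x)) E + sec (space N') x - 2 * sec E x"
proof -
  interpret F: prob_space "\<kappa>' (p x)" using fibre_facts[OF x] by simp
  note f = fibre_facts[OF x]
  let ?A = "Pair x -` A0"
  have "gap E x = F.prob (?A - E) + F.prob (E - ?A)"
    unfolding gap_def using f E by (intro F.finite_measure_Union) auto
  also have "F.prob (?A - E) = F.prob ?A - F.prob (?A \<inter> E)"
    using f E by (intro F.finite_measure_Diff') auto
  also have "F.prob (E - ?A) = F.prob E - F.prob (E \<inter> ?A)"
    using f E by (intro F.finite_measure_Diff') auto
  finally show ?thesis
    using sets.sets_into_space[OF f(4)] unfolding sec_def
    by (simp add: Int_commute Int_absorb1 Int_absorb2)
qed

lemma sec_near:
  assumes x: "x \<in> space X" and B: "B \<in> sets N'" and E: "E \<in> sets N'"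
  shows "\<bar>sec B x - measure (\<kappa>' (p x)) (E \<inter> B)\<bar> \<le> gap E x"
proof -
  interpret F: prob_space "\<kappa>' (p x)" using fibre_facts[OF x] by simp
  note f = fibre_facts[OF x]
  let ?A = "Pair x -` A0"
  have "F.prob (?A \<inter> B) \<le> F.prob ((E \<inter> B) \<union> sym_diff ?A E)"
    using f B E by (intro F.finite_measure_mono) auto
  also have "\<dots> \<le> F.prob (E \<inter> B) + gap E x"
    unfolding gap_def using f B E by (intro measure_Un_le) auto
  finally have 1: "sec B x \<le> F.prob (E \<inter> B) + gap E x" by (simp add: sec_def)
  have "F.prob (E \<inter> B) \<le> F.prob ((?A \<inter> B) \<union> sym_diff ?A E)"
    using f B E by (intro F.finite_measure_mono) auto
  also have "\<dots> \<le> sec B x + gap E x"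
    unfolding gap_def sec_def using f B E by (intro measure_Un_le) auto
  finally show ?thesis using 1 by linarith
qed

text \<open>The map \<open>t\<close> carries the fibre measure at \<open>p x\<close> to the one at
  \<open>p (T g x)\<close>, and by invariance of \<open>A\<close> it pulls the section at
  \<open>T g x\<close> back to the section at \<open>x\<close>, up to null sets. So moving the point
  amounts to moving the reference set.\<close>

lemma gap_act:
  assumes g: "g \<in> carrier G" and t: "t \<in> N' \<rightarrow>\<^sub>M N'" "AE x' in X'. t x' = T' g x'"
      "AE y in Y. distr (\<kappa>' y) N' t = \<kappa>' (S g y)"
    and E: "E \<in> sets N'"
  shows "AE x in X. gap E (T g x) = gap (t -` E \<inter> space N') x"
proof -
  have tT: "AE x in X. AE x' in \<kappa>' (p x). t x' = T' g x'"
    using E1.AE_p[OF E2.AE_\<kappa>[OF t(2)[unfolded E2.AE_X_iff]]] .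
  show ?thesis
    using version E1.X.AE_act[OF g version] E1.equivariant[OF g] E1.AE_p[OF t(3)] tT AE_space
  proof eventually_elim
    case (elim x)
    note f = fibre_facts[OF elim(6)]
    have Tx: "T g x \<in> space X" using E1.X.act_in_space[OF g elim(6)] .
    note f' = fibre_facts[OF Tx]
    have t': "t \<in> \<kappa>' (p x) \<rightarrow>\<^sub>M N'" using t(1) f(2) measurable_cong_sets by blast
    have d: "distr (\<kappa>' (p x)) N' t = \<kappa>' (p (T g x))" using elim(3,4) by simp
    let ?D = "sym_diff (Pair (T g x) -` A0) E" and ?D' = "sym_diff (Pair x -` A0) (t -` E \<inter> space N')"
    have D: "?D \<in> sets N'" using f' E by auto
    have tE: "t -` E \<inter> space N' \<in> sets N'" using measurable_sets[OF t(1) E] .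
    \<comment> \<open>The agreement of \<open>A\<close> and \<open>A0\<close> over
      \<open>T g x\<close> holds for the image measure and is pulled back along
      \<open>t\<close>.\<close>
    have ae2: "AE x' in \<kappa>' (p x). (T g x, t x') \<in> A \<longleftrightarrow> (T g x, t x') \<in> A0"
      using elim(2) AE_distrD[OF t'] unfolding d[symmetric] by blast
    have "gap E (T g x) = measure (distr (\<kappa>' (p x)) N' t) ?D" unfolding gap_def d ..
    also have "\<dots> = measure (\<kappa>' (p x)) (t -` ?D \<inter> space N')"
      using measure_distr[OF t' D] f(3) by simp
    also have "\<dots> = measure (\<kappa>' (p x)) ?D'"
    proof (rule measure_eq_AE)
      show "AE x' in \<kappa>' (p x). x' \<in> t -` ?D \<inter> space N' \<longleftrightarrow> x' \<in> ?D'"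
        using elim(1,5) ae2 AE_space
      proof eventually_elim
        case (elim x')
        then have "x' \<in> space X'" using f(3) E2.space_X by simp
        then have "(T g x, t x') \<in> A0 \<longleftrightarrow> (x, x') \<in> A0"
          using inv[OF g \<open>x \<in> space X\<close>] elim by simp
        then show ?case using elim(4) f(3) by auto
      qed
      show "t -` ?D \<inter> space N' \<in> sets (\<kappa>' (p x))" using measurable_sets[OF t(1) D] f(2) by simp
      show "?D' \<in> sets (\<kappa>' (p x))"
        unfolding f(2) by (intro sets.Un sets.Diff f(4) tE)
    qed
    finally show ?case unfolding gap_def .
  qed
qed

text \<open>For \<open>E = {}\<close> the gap is the measure of the whole section, and the empty
  reference set is its own preimage, so \<open>gap_act\<close> makes this measure invariant.\<close>

lemma sec_space_const:
  assumes erg: "ergodic G X T"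
  shows "AE x in X. sec (space N') x = (\<integral>x. sec (space N') x \<partial>X)"
proof (rule E1.X.ergodic_AE_invariant_const[OF erg])
  have gap0: "gap {} x = sec (space N') x" if "x \<in> space X" for x
    using gap_eq[OF that, of "{}"] by (simp add: sec_def)
  show "integrable X (sec (space N'))"
  proof (rule E1.X.integrable_const_bound)
    show "AE x in X. norm (sec (space N') x) \<le> 1"
      using AE_space by eventually_elim (simp add: sec_def prob_space.prob_le_1 fibre_facts)
  qed (simp add: sec_measurable)
  fix g assume g: "g \<in> carrier G"
  from g obtain t where t: "t \<in> N' \<rightarrow>\<^sub>M N'" "AE x' in X'. t x' = T' g x'"
      "AE y in Y. distr (\<kappa>' y) N' t = \<kappa>' (S g y)"
    by (rule E2.equivariant_kernel)
  show "AE x in X. sec (space N') (T g x) = sec (space N') x"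
    using gap_act[OF g t, of "{}", simplified] AE_space
    by eventually_elim (use gap0 E1.X.act_in_space[OF g] in auto)
qed

lemma gap_small:
  assumes V: "algebra (space N') \<V>" "sets N' = sigma_sets (space N') \<V>"
    and x: "x \<in> space X" and "\<epsilon> > 0"
  shows "\<exists>E\<in>\<V>. gap E x < \<epsilon>"
proof -
  interpret F: prob_space "\<kappa>' (p x)" using fibre_facts[OF x] by simp
  note f = fibre_facts[OF x]
  show ?thesis
    unfolding gap_def
  proof (rule algebra_approximation[OF F.finite_measure_axioms V(1) trans[OF f(2) V(2)] f(3)])
    show "Pair x -` A0 \<in> F.events" unfolding f(2) by (rule f(4))
  qed fact
qed

end

section \<open>The subalgebra generated by the sections\<close>

context dynamical_system
begin

lemma subalgebraD:
  assumes "complete_invariant_subalgebra G M T \<A>"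
  shows "sigma_algebra (space M) \<A>" "\<A> \<subseteq> sets M" "\<A> \<subseteq> Pow (space M)"
    "\<And>A B. A \<in> \<A> \<Longrightarrow> B \<in> sets M \<Longrightarrow> emeasure M (sym_diff A B) = 0 \<Longrightarrow> B \<in> \<A>"
    "\<And>A g. A \<in> \<A> \<Longrightarrow> g \<in> carrier G \<Longrightarrow> T g ` A \<in> \<A>"
  using assms sets.space_closed unfolding complete_invariant_subalgebra_def by blast+

lemma sets_subalgebra:
  "complete_invariant_subalgebra G M T \<A> \<Longrightarrow> sets (sigma (space M) \<A>) = \<A>"
  using subalgebraD(1,3) sigma_algebra.sigma_sets_eq by (metis sets_measure_of)

lemma space_subalgebra:
  "space (sigma (space M) \<A>) = space M"
  by (rule space_measure_of_conv)

text \<open>Completeness absorbs the null set on which the functions differ, so limits obtained only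
  almost everywhere can be used.\<close>

lemma measurable_subalgebra_AE_eq:
  fixes f f' :: "'a \<Rightarrow> real"
  assumes \<A>: "complete_invariant_subalgebra G M T \<A>"
    and f: "f \<in> borel_measurable (sigma (space M) \<A>)" and f': "f' \<in> borel_measurable M"
    and eq: "AE x in M. f x = f' x"
  shows "f' \<in> borel_measurable (sigma (space M) \<A>)"
proof (rule measurableI)
  fix B :: "real set" assume B: "B \<in> sets borel"
  have fB: "f -` B \<inter> space M \<in> \<A>"
    using measurable_sets[OF f B] by (simp add: space_subalgebra sets_subalgebra[OF \<A>])
  have f'B: "f' -` B \<inter> space M \<in> sets M" using measurable_sets[OF f' B] .
  have "AE x in M. x \<notin> sym_diff (f -` B \<inter> space M) (f' -` B \<inter> space M)"
    using eq by eventually_elim auto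
  then have "emeasure M (sym_diff (f -` B \<inter> space M) (f' -` B \<inter> space M)) = 0"
    using fB f'B subalgebraD(2)[OF \<A>] by (subst emeasure_eq_AE[where B = "{}"]) auto
  then show "f' -` B \<inter> space (sigma (space M) \<A>) \<in> sets (sigma (space M) \<A>)"
    using subalgebraD(4)[OF \<A> fB f'B] by (simp add: space_subalgebra sets_subalgebra[OF \<A>])
qed simp

lemma act_preimage_subalgebra:
  assumes \<A>: "complete_invariant_subalgebra G M T \<A>" and D: "D \<in> \<A>" and g: "g \<in> carrier G"
  shows "T g -` D \<inter> space M \<in> \<A>"
  using act_inv_image_eq_vimage[OF g, of D] subalgebraD(3)[OF \<A>] D subalgebraD(5)[OF \<A> D inv_closed[OF g]]
  by auto

text \<open>A cell of one partition is the countable union of its intersections with the cells of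
  the other, so a subalgebra contains the refinement exactly when it contains both.\<close>

lemma join_partition_subset:
  assumes \<A>: "complete_invariant_subalgebra G M T \<A>"
    and "countable_partition M \<alpha>" "countable_partition M \<beta>"
  shows "\<alpha> \<subseteq> \<A> \<Longrightarrow> \<beta> \<subseteq> \<A> \<Longrightarrow> join_partition \<alpha> \<beta> \<subseteq> \<A>"
    and "join_partition \<alpha> \<beta> \<subseteq> \<A> \<Longrightarrow> \<alpha> \<subseteq> \<A>"
    and "join_partition \<alpha> \<beta> \<subseteq> \<A> \<Longrightarrow> \<beta> \<subseteq> \<A>"
proof -
  interpret \<A>: sigma_algebra "space M" \<A> by (rule subalgebraD(1)[OF \<A>])
  have c: "countable \<alpha>" "countable \<beta>" "\<Union>\<alpha> = space M" "\<Union>\<beta> = space M"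
    using assms(2,3) by (auto simp: countable_partition_def)
  show "\<alpha> \<subseteq> \<A> \<Longrightarrow> \<beta> \<subseteq> \<A> \<Longrightarrow> join_partition \<alpha> \<beta> \<subseteq> \<A>"
    unfolding join_partition_def by auto
  assume j: "join_partition \<alpha> \<beta> \<subseteq> \<A>"
  have AB: "A \<inter> B \<in> \<A>" if "A \<in> \<alpha>" "B \<in> \<beta>" for A B
    using j that unfolding join_partition_def by auto
  show "\<alpha> \<subseteq> \<A>"
  proof
    fix A assume A: "A \<in> \<alpha>"
    then have "A = (\<Union>B\<in>\<beta>. A \<inter> B)" using c(3,4) by blast
    also have "\<dots> \<in> \<A>" using c(2) AB[OF A] by (intro \<A>.countable_UN') auto
    finally show "A \<in> \<A>" .
  qed
  show "\<beta> \<subseteq> \<A>"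
  proof
    fix B assume B: "B \<in> \<beta>"
    then have "B = (\<Union>A\<in>\<alpha>. A \<inter> B)" using c(3,4) by blast
    also have "\<dots> \<in> \<A>" using c(1) AB[OF _ B] by (intro \<A>.countable_UN') auto
    finally show "B \<in> \<A>" .
  qed
qed

end

lemma (in disintegrated_extension) p_measurable_subalgebra:
  assumes \<A>: "complete_invariant_subalgebra G X T \<A>" and sub: "factor_subalgebra X Y p \<subseteq> \<A>"
  shows "p \<in> sigma (space X) \<A> \<rightarrow>\<^sub>M Y"
proof (rule measurableI)
  show "p x \<in> space Y" if "x \<in> space (sigma (space X) \<A>)" for x
    using that measurable_space[OF p_measurable] by (simp add: X.space_subalgebra)
  fix C assume C: "C \<in> sets Y"
  have "p -` C \<inter> space X \<in> factor_subalgebra X Y p"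
    unfolding factor_subalgebra_def using C measurable_sets[OF p_measurable C] by (auto intro!: bexI[of _ C])
  then show "p -` C \<inter> space (sigma (space X) \<A>) \<in> sets (sigma (space X) \<A>)"
    using sub by (auto simp: X.space_subalgebra X.sets_subalgebra[OF \<A>])
qed

section \<open>Recovering the sections from small sets in a subalgebra\<close>

context invariant_pair
begin

lemma fibre_measure_measurable_subalgebra:
  assumes \<A>: "complete_invariant_subalgebra G X T \<A>" and sub: "factor_subalgebra X Y p \<subseteq> \<A>"
    and E: "E \<in> sets N'"
  shows "(\<lambda>x. measure (\<kappa>' (p x)) E) \<in> borel_measurable (sigma (space X) \<A>)"
  unfolding measure_def
  using measurable_compose[OF E1.p_measurable_subalgebra[OF \<A> sub] E2.\<kappa>_emeasure_measurable[OF E]]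
  by (rule borel_measurable_enn2real)

text \<open>On the preimage of \<open>D n\<close> under \<open>g\<close>, the section \<open>A0\<^sub>x\<close> is close to the preimage of \<open>E n\<close>
  under \<open>g\<close>, which does not depend on \<open>x\<close>; by ergodicity these preimages cover the space.\<close>

lemma sec_measurable_subalgebra:
  assumes erg: "ergodic G X T"
    and \<A>: "complete_invariant_subalgebra G X T \<A>" and sub: "factor_subalgebra X Y p \<subseteq> \<A>"
    and D: "\<And>n. D n \<in> \<A>" "\<And>n. emeasure X (D n) > 0" "\<And>n. D n \<subseteq> {x\<in>space X. gap (E n) x < 1 / Suc n}"
    and E: "\<And>n. E n \<in> sets N'" and B: "B \<in> sets N'"
  shows "sec B \<in> borel_measurable (sigma (space X) \<A>)"
proof -
  let ?\<A> = "sigma (space X) \<A>"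
  have DX: "D n \<in> sets X" for n using D(1) E1.X.subalgebraD(2)[OF \<A>] by blast
  have "\<forall>g\<in>carrier G. \<exists>t. t \<in> N' \<rightarrow>\<^sub>M N' \<and> (AE x' in X'. t x' = T' g x')
      \<and> (AE y in Y. distr (\<kappa>' y) N' t = \<kappa>' (S g y))"
  proof
    fix g assume "g \<in> carrier G"
    from E2.equivariant_kernel[OF this]
    show "\<exists>t. t \<in> N' \<rightarrow>\<^sub>M N' \<and> (AE x' in X'. t x' = T' g x') \<and> (AE y in Y. distr (\<kappa>' y) N' t = \<kappa>' (S g y))"
      by blast
  qed
  from bchoice[OF this] obtain t where t: "\<And>g. g \<in> carrier G \<Longrightarrow> t g \<in> N' \<rightarrow>\<^sub>M N'"
    "\<And>g. g \<in> carrier G \<Longrightarrow> AE x' in X'. t g x' = T' g x'"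
    "\<And>g. g \<in> carrier G \<Longrightarrow> AE y in Y. distr (\<kappa>' y) N' (t g) = \<kappa>' (S g y)" by blast
  define E' where "E' n g = t g -` E n \<inter> space N'" for n g
  have E': "E' n g \<in> sets N'" if "g \<in> carrier G" for n g
    unfolding E'_def using measurable_sets[OF t(1)[OF that] E] .
  define e where "e = from_nat_into (carrier G)"
  have e_in: "e k \<in> carrier G" for k
    unfolding e_def using E1.X.one_closed by (intro from_nat_into) auto
  have e_surj: "\<exists>k. e k = g" if "g \<in> carrier G" for g
    unfolding e_def using from_nat_into_surj[OF E1.X.countable_group that] by blast
  \<comment> \<open>The first translate in the enumeration that brings \<open>x\<close> into
    \<open>D n\<close>, a choice measurable for the subalgebra. Where there is none the value is
    arbitrary, which concerns only a null set.\<close>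
  define k where "k n x = (LEAST k. T (e k) x \<in> D n)" for n x
  define \<psi> where "\<psi> n x = measure (\<kappa>' (p x)) (E' n (e (k n x)) \<inter> B)" for n x
  have km: "k n \<in> ?\<A> \<rightarrow>\<^sub>M count_space UNIV" for n
    unfolding k_def
  proof (rule measurable_Least)
    fix i
    have "{x \<in> space ?\<A>. T (e i) x \<in> D n} = T (e i) -` D n \<inter> space X"
      by (auto simp: E1.X.space_subalgebra)
    also have "\<dots> \<in> \<A>" by (rule E1.X.act_preimage_subalgebra[OF \<A> D(1) e_in])
    finally show "Measurable.pred ?\<A> (\<lambda>x. T (e i) x \<in> D n)"
      by (simp add: pred_def E1.X.sets_subalgebra[OF \<A>])
  qed
  \<comment> \<open>For a fixed translate the reference set is fixed and only \<open>p x\<close>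
    varies; \<open>\<psi> n\<close> glues countably many such functions along
    \<open>k n\<close>.\<close>
  have \<psi>m: "\<psi> n \<in> borel_measurable ?\<A>" for n
    unfolding \<psi>_def
    by (rule measurable_compose_countable[OF _ km, of "\<lambda>i x. measure (\<kappa>' (p x)) (E' n (e i) \<inter> B)"])
      (intro fibre_measure_measurable_subalgebra[OF \<A> sub] sets.Int E' e_in B)
  have "AE x in X. \<forall>n. \<forall>g\<in>carrier G. gap (E n) (T g x) = gap (E' n g) x"
    unfolding E'_def
    by (intro AE_all_countable[THEN iffD2] allI AE_ball_countable[OF E1.X.countable_group, THEN iffD2] ballI
        gap_act[OF _ t E])
  moreover have "AE x in X. \<forall>n. \<exists>g\<in>carrier G. T g x \<in> D n"
    by (intro AE_all_countable[THEN iffD2] allI E1.X.ergodic_orbit_meets[OF erg DX D(2)])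
  \<comment> \<open>Convergence is known only for almost every \<open>x\<close>, so the total
    function \<open>lim\<close> is used and completeness of the subalgebra removes the
    exceptions.\<close>
  ultimately have "AE x in X. lim (\<lambda>n. \<psi> n x) = sec B x"
    using AE_space
  proof eventually_elim
    case (elim x)
    have "\<bar>\<psi> n x - sec B x\<bar> \<le> 1 / Suc n" for n
    proof -
      obtain i where "T (e i) x \<in> D n" using elim(2) e_surj by metis
      then have "T (e (k n x)) x \<in> D n" unfolding k_def by (rule LeastI)
      then have "gap (E n) (T (e (k n x)) x) < 1 / Suc n" using D(3) by auto
      then have "gap (E' n (e (k n x))) x < 1 / Suc n" using elim(1) e_in by simp
      moreover have "\<bar>sec B x - \<psi> n x\<bar> \<le> gap (E' n (e (k n x))) x"
        unfolding \<psi>_def by (rule sec_near[OF elim(3) B E'[OF e_in]])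
      ultimately show ?thesis by linarith
    qed
    then have "(\<lambda>n. \<psi> n x - sec B x) \<longlonglongrightarrow> 0"
      by (intro Lim_null_comparison[OF always_eventually LIMSEQ_inverse_real_of_nat] allI)
        (simp only: real_norm_def inverse_eq_divide)
    then have "(\<lambda>n. \<psi> n x) \<longlonglongrightarrow> sec B x" by (rule LIM_zero_cancel)
    then show ?case by (rule limI)
  qed
  then show ?thesis
    by (intro E1.X.measurable_subalgebra_AE_eq[OF \<A> borel_measurable_lim_metric[OF \<psi>m] sec_measurable[OF B]])
qed

text \<open>Generation is defined for families of sets, so the functions \<open>sec B\<close> enter
  through their sublevel sets.\<close>

definition enlarged :: "'a set set" where
  "enlarged = generated_subalgebra G X T
    (factor_subalgebra X Y p \<union> {{x\<in>space X. sec B x < r} | B r. B \<in> sets N'})"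

lemma enlarged_subalgebra:
  shows "complete_invariant_subalgebra G X T enlarged"
    and "factor_subalgebra X Y p \<subseteq> enlarged"
    and "B \<in> sets N' \<Longrightarrow> sec B \<in> borel_measurable (sigma (space X) enlarged)"
proof -
  let ?\<alpha> = "factor_subalgebra X Y p \<union> {{x\<in>space X. sec B x < r} | B r. B \<in> sets N'}"
  have \<alpha>: "?\<alpha> \<subseteq> sets X"
    using sec_measurable borel_measurable_less[OF sec_measurable borel_measurable_const]
    by (auto simp: factor_subalgebra_def)
  show c: "complete_invariant_subalgebra G X T enlarged"
    unfolding enlarged_def by (rule E1.X.complete_invariant_generated[OF \<alpha>])
  have s: "?\<alpha> \<subseteq> enlarged"
    unfolding enlarged_def by (rule E1.X.complete_invariant_generated[OF \<alpha>])
  then show "factor_subalgebra X Y p \<subseteq> enlarged" by blast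
  show "sec B \<in> borel_measurable (sigma (space X) enlarged)" if "B \<in> sets N'"
    unfolding borel_measurable_iff_less
    using s that by (auto simp: E1.X.space_subalgebra E1.X.sets_subalgebra[OF c])
qed

lemma gap_measurable_subalgebra:
  assumes \<A>: "complete_invariant_subalgebra G X T \<A>" and sub: "factor_subalgebra X Y p \<subseteq> \<A>"
    and sec: "\<And>B. B \<in> sets N' \<Longrightarrow> sec B \<in> borel_measurable (sigma (space X) \<A>)"
    and E: "E \<in> sets N'"
  shows "{x\<in>space X. gap E x < r} \<in> \<A>"
proof -
  let ?f = "\<lambda>x. measure (\<kappa>' (p x)) E + sec (space N') x - 2 * sec E x"
  have "?f \<in> borel_measurable (sigma (space X) \<A>)"
    by (intro borel_measurable_diff borel_measurable_add borel_measurable_times borel_measurable_const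
        fibre_measure_measurable_subalgebra[OF \<A> sub E] sec sets.top E)
  then have "{x\<in>space X. ?f x < r} \<in> \<A>"
    unfolding borel_measurable_iff_less by (simp add: E1.X.space_subalgebra E1.X.sets_subalgebra[OF \<A>])
  moreover have "{x\<in>space X. ?f x < r} = {x\<in>space X. gap E x < r}" using gap_eq[OF _ E] by auto
  ultimately show ?thesis by simp
qed

end

text \<open>Each set loses the later, smaller ones: these have total measure at most
  \<open>prob (D n) * (1/4 + 1/16 + ...)\<close>, a third of its own, so a positive part remains.
  Subtracting the earlier sets could leave nothing.\<close>

lemma (in prob_space) disjointify_decreasing:
  assumes D: "\<And>n. D n \<in> sets M" "\<And>n. prob (D n) > 0" "\<And>n. prob (D (Suc n)) \<le> prob (D n) / 4"
  defines "D' \<equiv> \<lambda>n. D n - (\<Union>i. D (Suc (n + i)))"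
  shows "disjoint_family D'" "\<And>n. prob (D' n) > 0"
proof -
  show "disjoint_family D'"
    unfolding disjoint_family_on_def
  proof (intro ballI impI)
    fix m n :: nat assume "m \<noteq> n"
    then show "D' m \<inter> D' n = {}"
    proof (induction m n rule: linorder_wlog)
      case (le a b)
      then obtain i where "b = Suc (a + i)" using less_imp_Suc_add[of a b] by auto
      then show ?case unfolding D'_def by blast
    next
      case (sym a b)
      then show ?case by (simp add: Int_commute)
    qed
  qed
  fix n
  have le: "prob (D (Suc (n + i))) \<le> prob (D n) / 4 * (1/4)^i" for i
  proof (induction i)
    case (Suc i)
    have "prob (D (Suc (n + Suc i))) \<le> prob (D (Suc (n + i))) / 4" using D(3)[of "Suc (n + i)"] by simp
    then show ?case using Suc by simp
  qed (use D(3) in simp)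
  have geo: "(\<lambda>i. prob (D n) / 4 * (1/4)^i) sums (prob (D n) / 4 * (4/3))"
    using sums_mult[OF geometric_sums[of "1/4::real"], of "prob (D n) / 4"] by simp
  have sD: "summable (\<lambda>i. prob (D (Suc (n + i))))"
    by (rule summable_comparison_test'[OF sums_summable[OF geo], of 0])
      (simp only: real_norm_def abs_of_nonneg measure_nonneg le)
  have "prob (\<Union>i. D (Suc (n + i))) \<le> (\<Sum>i. prob (D (Suc (n + i))))"
    using D(1) sD by (intro finite_measure_subadditive_countably) auto
  also have "\<dots> \<le> (\<Sum>i. prob (D n) / 4 * (1/4)^i)"
    by (intro suminf_le le sD sums_summable[OF geo])
  also have "\<dots> = prob (D n) / 3" using sums_unique[OF geo] by simp
  finally have "prob (\<Union>i. D (Suc (n + i))) \<le> prob (D n) / 3" .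
  moreover have "prob (D n) \<le> prob (D' n \<union> (\<Union>i. D (Suc (n + i))))"
    unfolding D'_def using D(1) by (intro finite_measure_mono) auto
  moreover have "\<dots> \<le> prob (D' n) + prob (\<Union>i. D (Suc (n + i)))"
    unfolding D'_def using D(1) by (intro measure_Un_le) auto
  ultimately show "prob (D' n) > 0" using D(2)[of n] by linarith
qed

text \<open>The base points over which \<open>C\<close> has positive fibre measure form a set
  \<open>W\<close> of positive measure, and a small \<open>B\<close> inside \<open>W\<close> cuts
  \<open>C\<close> in positive measure. Cutting by a set of the factor, unlike passing to an
  arbitrary subset, stays in every subalgebra that contains \<open>C\<close> and the factor.\<close>

lemma (in disintegrated_extension) small_subset:
  assumes na: "nonatomic Y" and C: "C \<in> sets X" "X.prob C > 0" and "\<eta> > 0"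
  obtains B where "B \<in> sets Y" "0 < X.prob (p -` B \<inter> C)" "X.prob (p -` B \<inter> C) < \<eta>"
proof -
  obtain C0 Q Q' where Q: "C = C0 \<union> Q" "Q \<subseteq> Q'" "Q' \<in> null_sets N" "C0 \<in> sets N"
    using C(1) unfolding X_eq by (rule sets_completionE)
  have "AE x in X. x \<in> C \<longleftrightarrow> x \<in> C0"
    unfolding AE_X_iff using AE_not_in[OF Q(3)] by eventually_elim (use Q in auto)
  then have "emeasure X C = emeasure X C0" using C(1) sets_N_X[OF Q(4)] by (rule emeasure_eq_AE)
  then have "emeasure X C0 > 0" using C(2) by (simp add: X.emeasure_eq_measure)
  then have pos: "(\<integral>\<^sup>+y. emeasure (\<kappa> y) C0 \<partial>Y) > 0"
    using emeasure_X[OF Q(4)] emeasure_N[OF Q(4)] by simp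
  note m = \<kappa>_emeasure_measurable[OF Q(4)]
  define W where "W = {y\<in>space Y. emeasure (\<kappa> y) C0 \<noteq> 0}"
  have W: "W \<in> sets Y" unfolding W_def using m by measurable
  have "emeasure Y W \<noteq> 0"
  proof
    assume "emeasure Y W = 0"
    then have "AE y in Y. emeasure (\<kappa> y) C0 = 0"
      using W unfolding W_def by (subst AE_iff_measurable[OF _ refl]) auto
    then have "(\<integral>\<^sup>+y. emeasure (\<kappa> y) C0 \<partial>Y) = 0"
      unfolding nn_integral_0_iff_AE[OF m] .
    with pos show False by simp
  qed
  then have "Y.prob W > 0" by (simp add: Y.emeasure_eq_measure less_le)
  then obtain B where B: "B \<in> sets Y" "B \<subseteq> W" "0 < Y.prob B" "Y.prob B < \<eta>"
    using Y.nonatomic_small_subset[OF na W _ \<open>\<eta> > 0\<close>] by blast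
  have pB: "p -` B \<inter> space X \<in> sets X" using measurable_sets[OF p_measurable B(1)] .
  have eqC: "p -` B \<inter> C = (p -` B \<inter> space X) \<inter> C" "p -` B \<inter> C0 = (p -` B \<inter> space X) \<inter> C0"
    using sets.sets_into_space[OF C(1)] Q(1) by auto
  have pBC: "p -` B \<inter> C \<in> sets X" "p -` B \<inter> C0 \<in> sets X"
    unfolding eqC by (intro sets.Int pB C(1) sets_N_X[OF Q(4)])+
  have "X.prob (p -` B \<inter> C) \<le> X.prob (p -` B \<inter> space X)"
    using pB sets.sets_into_space[OF C(1)] by (intro X.finite_measure_mono) auto
  also have "\<dots> = measure (distr X Y p) B" using measure_distr[OF p_measurable B(1)] by simp
  also have "\<dots> = Y.prob B" by (simp add: distr_p)
  finally have lt: "X.prob (p -` B \<inter> C) < \<eta>" using B(4) by simp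
  have m': "(\<lambda>y. emeasure (\<kappa> y) C0 * indicator B y) \<in> borel_measurable Y"
    using m borel_measurable_indicator[OF B(1)] by (rule borel_measurable_times_ennreal)
  have "emeasure X (p -` B \<inter> C0) \<noteq> 0"
  proof
    assume "emeasure X (p -` B \<inter> C0) = 0"
    then have "AE y in Y. emeasure (\<kappa> y) C0 * indicator B y = 0"
      unfolding emeasure_fibre_inter[OF B(1) Q(4)] nn_integral_0_iff_AE[OF m'] .
    then have "AE y in Y. y \<notin> B"
      using AE_space by eventually_elim (use B(2) in \<open>auto simp: W_def indicator_def split: if_splits\<close>)
    then have "emeasure Y B = emeasure Y {}" using B(1) by (intro emeasure_eq_AE) auto
    then show False using B(3) by (simp add: Y.emeasure_eq_measure)
  qed
  moreover have "emeasure X (p -` B \<inter> C0) \<le> emeasure X (p -` B \<inter> C)"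
    using pBC Q(1) by (intro emeasure_mono) auto
  ultimately have "emeasure X (p -` B \<inter> C) \<noteq> 0" by auto
  then have "X.prob (p -` B \<inter> C) > 0"
    by (simp add: X.emeasure_eq_measure less_le)
  then show ?thesis using B(1) lt that by blast
qed

section \<open>Zero entropy of the enlarged subalgebra\<close>

context invariant_pair
begin

text \<open>By \<open>gap_small\<close> the countably many sets where the gap to a member of
  \<open>\<V>\<close> is below \<open>\<epsilon>\<close> cover the space, so they cannot all be
  null.\<close>

lemma gap_positive:
  assumes V: "countable \<V>" "algebra (space N') \<V>" "sets N' = sigma_sets (space N') \<V>" and "\<epsilon> > 0"
  obtains E where "E \<in> sets N'" "E1.X.prob {x\<in>space X. gap E x < \<epsilon>} > 0"
proof -
  have VN: "E \<in> sets N'" if "E \<in> \<V>" for E using that V(3) by auto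
  have m: "{x\<in>space X. gap E x < \<epsilon>} \<in> sets X" if "E \<in> \<V>" for E
    using gap_measurable_subalgebra[OF enlarged_subalgebra VN[OF that], of \<epsilon>]
      E1.X.subalgebraD(2)[OF enlarged_subalgebra(1)] by blast
  have "\<exists>E\<in>\<V>. E1.X.prob {x\<in>space X. gap E x < \<epsilon>} \<noteq> 0"
  proof (rule ccontr)
    assume "\<not> ?thesis"
    then have "{x\<in>space X. gap E x < \<epsilon>} \<in> null_sets X" if "E \<in> \<V>" for E
      using m[OF that] that by (auto simp: null_sets_def E1.X.emeasure_eq_measure)
    then have "(\<Union>E\<in>\<V>. {x\<in>space X. gap E x < \<epsilon>}) \<in> null_sets X" using V(1) by (intro null_sets_UN') auto
    moreover have "(\<Union>E\<in>\<V>. {x\<in>space X. gap E x < \<epsilon>}) = space X"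
      using gap_small[OF V(2,3) _ \<open>\<epsilon> > 0\<close>] by blast
    ultimately show False using E1.X.emeasure_space_1 by (auto simp: null_sets_def)
  qed
  then show ?thesis using that VN by (metis less_le measure_nonneg)
qed

text \<open>Here nonatomicity enters. \<open>\<epsilon>\<close> controls how well the set determines
  the sections and \<open>\<eta>\<close> what it costs in entropy; the two can be prescribed
  independently.\<close>

lemma enlarged_small_set:
  assumes na: "nonatomic Y" and V: "countable \<V>" "algebra (space N') \<V>" "sets N' = sigma_sets (space N') \<V>"
    and "\<epsilon> > 0" "\<eta> > 0"
  shows "\<exists>D\<in>enlarged. (\<exists>E\<in>sets N'. D \<subseteq> {x\<in>space X. gap E x < \<epsilon>}) \<and> 0 < E1.X.prob D \<and> E1.X.prob D \<le> \<eta>"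
proof -
  interpret B: sigma_algebra "space X" enlarged
    by (rule E1.X.subalgebraD(1)[OF enlarged_subalgebra(1)])
  obtain E where E: "E \<in> sets N'" "E1.X.prob {x\<in>space X. gap E x < \<epsilon>} > 0" (is "E1.X.prob ?C > 0")
    using gap_positive[OF V \<open>\<epsilon> > 0\<close>] .
  have C: "?C \<in> enlarged" by (rule gap_measurable_subalgebra[OF enlarged_subalgebra E(1)])
  then have CX: "?C \<in> sets X" using E1.X.subalgebraD(2)[OF enlarged_subalgebra(1)] by blast
  obtain B where B: "B \<in> sets Y" "0 < E1.X.prob (p -` B \<inter> ?C)" "E1.X.prob (p -` B \<inter> ?C) < \<eta>"
    using E1.small_subset[OF na CX E(2) \<open>\<eta> > 0\<close>] .
  have "p -` B \<inter> space X \<in> enlarged"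
    using measurable_sets[OF E1.p_measurable_subalgebra[OF enlarged_subalgebra(1,2)] B(1)]
    by (simp add: E1.X.space_subalgebra E1.X.sets_subalgebra[OF enlarged_subalgebra(1)])
  then have "(p -` B \<inter> space X) \<inter> ?C \<in> enlarged" using C by (rule B.Int)
  moreover have "(p -` B \<inter> space X) \<inter> ?C = p -` B \<inter> ?C" by auto
  ultimately show ?thesis using B E(1)
    by (intro bexI[of _ "p -` B \<inter> ?C"] conjI bexI[of _ E]) auto
qed

text \<open>The partition into the disjointified sets \<^term>\<open>D n\<close> has small entropy and, together with the
  factor, generates \<^const>\<open>enlarged\<close>.\<close>

lemma enlarged_zero_entropy:
  assumes erg: "ergodic G X T" and na: "nonatomic Y"
    and zero: "zero_entropy_subalgebra G X T (factor_subalgebra X Y p)"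
  shows "zero_entropy_subalgebra G X T enlarged"
proof -
  let ?F = "factor_subalgebra X Y p"
  note B = enlarged_subalgebra
  interpret B: sigma_algebra "space X" enlarged by (rule E1.X.subalgebraD(1)[OF B(1)])
  have "standard_borel N'" using E2.model unfolding borel_model_def by blast
  then obtain \<V> where V: "countable \<V>" "algebra (space N') \<V>" "sets N' = sigma_sets (space N') \<V>"
    by (rule standard_borel_countable_algebra)
  have le: "rokhlin_entropy G X T enlarged \<le> ennreal e" if "e > 0" for e
  proof -
    \<comment> \<open>\<open>6 * c\<close> is the entropy bound of
      \<open>shannon_entropy_small_sets\<close>, which also asks for \<open>c \<le> 1\<close>; it
      must fit into \<open>e / 2\<close>, the other half being left to a generating partition of the
      factor.\<close>
    define c where "c = min 1 (e / 12)"
    have c: "0 < c" "c \<le> 1" "6 * c \<le> e / 2" using \<open>e > 0\<close> by (auto simp: c_def)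
    have "rokhlin_entropy G X T ?F < ennreal (e / 2)"
      using zero \<open>e > 0\<close> unfolding zero_entropy_subalgebra_def by simp
    then obtain \<gamma> where \<gamma>: "countable_partition X \<gamma>" "\<gamma> \<subseteq> ?F" "generated_subalgebra G X T \<gamma> = ?F"
      "shannon_entropy X \<gamma> < ennreal (e / 2)"
      unfolding rokhlin_entropy_def Inf_less_iff by auto
    let ?P = "\<lambda>n D. D \<in> enlarged \<and> (\<exists>E\<in>sets N'. D \<subseteq> {x\<in>space X. gap E x < 1 / Suc n})
      \<and> 0 < E1.X.prob D \<and> E1.X.prob D \<le> c^2"
    \<comment> \<open>The ratio 1/4 yields the bound \<open>(c * (1/2)^n)^2\<close> needed for small
      entropy, whose case \<open>n = 0\<close> is the starting bound \<open>c^2\<close>, and it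
      leaves enough mass when the sets are made disjoint.\<close>
    have "\<exists>D. \<forall>n. ?P n (D n) \<and> E1.X.prob (D (Suc n)) \<le> E1.X.prob (D n) / 4"
    proof (rule dependent_nat_choice)
      show "\<exists>D. ?P 0 D"
        using enlarged_small_set[OF na V, of "1 / Suc 0" "c^2"] c by auto
      fix D n assume D: "?P n D"
      then obtain D' where D': "D' \<in> enlarged" "\<exists>E\<in>sets N'. D' \<subseteq> {x\<in>space X. gap E x < 1 / Suc (Suc n)}"
        "0 < E1.X.prob D'" "E1.X.prob D' \<le> E1.X.prob D / 4"
        using enlarged_small_set[OF na V, of "1 / Suc (Suc n)" "E1.X.prob D / 4"] by auto
      then have "E1.X.prob D' \<le> c^2" using D by auto
      then show "\<exists>D'. ?P (Suc n) D' \<and> E1.X.prob D' \<le> E1.X.prob D / 4" using D' by blast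
    qed
    then obtain D where D: "\<And>n. D n \<in> enlarged" "\<And>n. \<exists>E\<in>sets N'. D n \<subseteq> {x\<in>space X. gap E x < 1 / Suc n}"
      "\<And>n. 0 < E1.X.prob (D n)" "\<And>n. E1.X.prob (D n) \<le> c^2"
      "\<And>n. E1.X.prob (D (Suc n)) \<le> E1.X.prob (D n) / 4" by blast
    have DX: "D n \<in> sets X" for n using D(1) E1.X.subalgebraD(2)[OF B(1)] by blast
    define D' where "D' n = D n - (\<Union>i. D (Suc (n + i)))" for n
    have D': "disjoint_family D'" "\<And>n. E1.X.prob (D' n) > 0"
      using E1.X.disjointify_decreasing[of D, OF DX D(3,5)] unfolding D'_def[abs_def] by auto
    have D'B: "D' n \<in> enlarged" for n
      unfolding D'_def using D(1) by (intro B.Diff B.countable_UN) auto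
    have D'X: "D' n \<in> sets X" for n using D'B E1.X.subalgebraD(2)[OF B(1)] by blast
    have sub: "D' n \<subseteq> D n" for n unfolding D'_def by blast
    have "E1.X.prob (D n) \<le> (c * (1/2)^n)^2" for n
    proof (induction n)
      case (Suc n)
      have "E1.X.prob (D (Suc n)) \<le> (c * (1/2)^n)^2 / 4" using D(5)[of n] Suc by linarith
      then show ?case by (simp add: power_mult_distrib power2_eq_square)
    qed (use D(4) in simp)
    then have small: "E1.X.prob (D' n) \<le> (c * (1/2)^n)^2" for n
      using E1.X.finite_measure_mono[OF sub DX] order_trans by blast
    define \<delta> where "\<delta> = insert (space X - (\<Union>n. D' n)) (range D')"
    have \<delta>: "countable_partition X \<delta>" "shannon_entropy X \<delta> \<le> ennreal (6 * c)"
      unfolding \<delta>_def using E1.X.shannon_entropy_small_sets[OF D'X D'(1) small] c by auto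
    have \<delta>B: "\<delta> \<subseteq> enlarged" unfolding \<delta>_def using D'B by auto
    define \<alpha> where "\<alpha> = join_partition \<gamma> \<delta>"
    have \<alpha>: "countable_partition X \<alpha>" unfolding \<alpha>_def by (rule countable_partition_join[OF \<gamma>(1) \<delta>(1)])
    have \<alpha>B: "\<alpha> \<subseteq> enlarged"
      unfolding \<alpha>_def using \<gamma>(2) B(2) \<delta>B by (intro E1.X.join_partition_subset(1)[OF B(1) \<gamma>(1) \<delta>(1)]) auto
    let ?E = "generated_subalgebra G X T \<alpha>"
    have \<alpha>X: "\<alpha> \<subseteq> sets X" using \<alpha> by (simp add: countable_partition_def)
    note E = E1.X.complete_invariant_generated[OF \<alpha>X]
    have "?E = enlarged"
    proof
      show "?E \<subseteq> enlarged" by (rule generated_subalgebra_least[OF B(1) \<alpha>B])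
      have "\<gamma> \<subseteq> ?E" "\<delta> \<subseteq> ?E"
        using E1.X.join_partition_subset(2,3)[OF E(1) \<gamma>(1) \<delta>(1)] E(2) unfolding \<alpha>_def by auto
      then have FE: "?F \<subseteq> ?E" and D'E: "\<And>n. D' n \<in> ?E"
        using generated_subalgebra_least[OF E(1), of \<gamma>] \<gamma>(3) unfolding \<delta>_def by auto
      have "\<exists>E. \<forall>n. E n \<in> sets N' \<and> D' n \<subseteq> {x\<in>space X. gap (E n) x < 1 / Suc n}"
        using D(2) sub by (intro choice allI) (meson order_trans)
      then obtain E' where E': "\<And>n. E' n \<in> sets N'" "\<And>n. D' n \<subseteq> {x\<in>space X. gap (E' n) x < 1 / Suc n}"
        by blast
      \<comment> \<open>\<open>?E\<close> contains the factor and, for every \<open>n\<close>, a set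
        of positive measure with gap below \<open>1 / Suc n\<close>, so it already measures every
        \<open>sec C\<close>.\<close>
      have "sec C \<in> borel_measurable (sigma (space X) ?E)" if "C \<in> sets N'" for C
        by (rule sec_measurable_subalgebra[OF erg E(1) FE D'E _ E'(2,1) that])
          (use D'(2) in \<open>simp add: E1.X.emeasure_eq_measure\<close>)
      then have "{x\<in>space X. sec C x < r} \<in> ?E" if "C \<in> sets N'" for C r
        using that unfolding borel_measurable_iff_less
        by (simp add: E1.X.space_subalgebra E1.X.sets_subalgebra[OF E(1)])
      then show "enlarged \<subseteq> ?E"
        unfolding enlarged_def using FE by (intro generated_subalgebra_least[OF E(1)]) auto
    qed
    then have "rokhlin_entropy G X T enlarged \<le> shannon_entropy X \<alpha>"
      unfolding rokhlin_entropy_def using \<alpha> \<alpha>B by (intro Inf_lower) blast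
    also have "\<dots> \<le> shannon_entropy X \<gamma> + shannon_entropy X \<delta>"
      unfolding \<alpha>_def by (rule E1.X.shannon_entropy_join_le[OF \<gamma>(1) \<delta>(1)])
    also have "\<dots> \<le> ennreal (e / 2) + ennreal (e / 2)"
      using \<gamma>(4) \<delta>(2) ennreal_leI[OF c(3)] by (intro add_mono) auto
    also have "\<dots> = ennreal e" using \<open>e > 0\<close> by (simp add: ennreal_plus[symmetric] del: ennreal_plus)
    finally show ?thesis .
  qed
  have "rokhlin_entropy G X T enlarged \<le> 0"
    by (rule ennreal_le_epsilon) (simp add: le)
  then show ?thesis unfolding zero_entropy_subalgebra_def using B(1) by simp
qed

end

text \<open>Over the set where \<open>f\<close> exceeds \<open>h\<close> the difference is positive,
  so equal finite integrals force that set to be null. Only this one set is tested, so it suffices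
  that it lies in a subalgebra over which the integrals are known to agree.\<close>

lemma AE_le_if_superlevel_integrals_eq:
  fixes f h :: "'a \<Rightarrow> real"
  assumes f: "f \<in> borel_measurable M" and h: "h \<in> borel_measurable M"
    and nonneg: "\<And>x. x \<in> space M \<Longrightarrow> 0 \<le> h x"
    and fin: "(\<integral>\<^sup>+x. ennreal (h x) \<partial>M) \<noteq> \<infinity>"
    and eq: "(\<integral>\<^sup>+x\<in>{x\<in>space M. h x < f x}. ennreal (f x) \<partial>M) = (\<integral>\<^sup>+x\<in>{x\<in>space M. h x < f x}. ennreal (h x) \<partial>M)"
  shows "AE x in M. f x \<le> h x"
proof -
  let ?W = "{x\<in>space M. h x < f x}"
  let ?f = "\<lambda>x. ennreal (f x) * indicator ?W x" and ?h = "\<lambda>x. ennreal (h x) * indicator ?W x"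
  have W: "?W \<in> sets M" using f h by measurable
  have fm: "?f \<in> borel_measurable M"
    by (intro borel_measurable_times_ennreal borel_measurable_indicator W measurable_compose[OF f measurable_ennreal])
  have hm: "?h \<in> borel_measurable M"
    by (intro borel_measurable_times_ennreal borel_measurable_indicator W measurable_compose[OF h measurable_ennreal])
  have "(\<integral>\<^sup>+x. ?h x \<partial>M) \<le> (\<integral>\<^sup>+x. ennreal (h x) \<partial>M)"
    by (intro nn_integral_mono) (auto simp: indicator_def)
  then have finh: "(\<integral>\<^sup>+x. ?h x \<partial>M) \<noteq> \<infinity>" using fin by (auto simp: top_unique)
  have "(\<integral>\<^sup>+x. ?f x - ?h x \<partial>M) = (\<integral>\<^sup>+x. ?f x \<partial>M) - (\<integral>\<^sup>+x. ?h x \<partial>M)"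
    by (rule nn_integral_diff[OF fm hm finh]) (auto simp: indicator_def ennreal_leI)
  also have "\<dots> = 0" unfolding eq by (rule ennreal_diff_self) (use finh in simp)
  finally have "AE x in M. ?f x - ?h x = 0"
    using nn_integral_0_iff_AE[of "\<lambda>x. ?f x - ?h x" M] fm hm by (simp add: borel_measurable_minus_ennreal)
  then show ?thesis
    using AE_space
  proof eventually_elim
    case (elim x)
    show ?case
    proof (rule ccontr)
      assume "\<not> f x \<le> h x"
      then have "ennreal (f x) - ennreal (h x) = 0" "h x < f x" using elim by auto
      then show False
        using nonneg[OF elim(2)] by (simp add: ennreal_minus ennreal_eq_0_iff)
    qed
  qed
qed

section \<open>Triviality of invariant sets\<close>

context invariant_pair
begin

lemma sec_le_1: "x \<in> space X \<Longrightarrow> sec B x \<le> 1"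
  and sec_nonneg: "0 \<le> sec B x"
  unfolding sec_def by (simp_all add: prob_space.prob_le_1 fibre_facts)

text \<open>With the section itself as \<open>B\<close>, its measure \<open>s\<close> would satisfy
  \<open>s = c * s\<close>, hence vanish. Proportionality is available only on an algebra, so a
  member \<open>E\<close> close to the section stands in for it.\<close>

lemma section_null_of_proportional:
  assumes V: "algebra (space N') \<V>" "sets N' = sigma_sets (space N') \<V>"
    and x: "x \<in> space X" and proportional: "\<And>B. B \<in> \<V> \<Longrightarrow> sec B x = c * measure (\<kappa>' (p x)) B"
    and c: "0 \<le> c" "c < 1"
  shows "sec (space N') x = 0"
proof (rule ccontr)
  assume "sec (space N') x \<noteq> 0"
  then have pos: "0 < sec (space N') x" using sec_nonneg[of "space N'" x] by linarith
  \<comment> \<open>Two errors below \<open>\<epsilon>\<close> arise from replacing the section by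
    \<open>E\<close>; with \<open>s\<close> the measure of the section they give
    \<open>(1 - c) * s < 2 * \<epsilon>\<close>, which is half of the left side.\<close>
  define \<epsilon> where "\<epsilon> = (1 - c) * sec (space N') x / 4"
  have "\<epsilon> > 0" using pos c by (simp add: \<epsilon>_def)
  then obtain E where E: "E \<in> \<V>" "gap E x < \<epsilon>" using gap_small[OF V x] by blast
  then have EN: "E \<in> sets N'" using V(2) by auto
  let ?m = "measure (\<kappa>' (p x)) E"
  have ES: "E \<inter> space N' = E" using sets.sets_into_space[OF EN] by auto
  have 1: "\<bar>c * ?m - ?m\<bar> < \<epsilon>" using sec_near[OF x EN EN] proportional[OF E(1)] E(2) by simp
  have 2: "\<bar>sec (space N') x - ?m\<bar> < \<epsilon>" using sec_near[OF x sets.top EN] E(2) ES by simp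
  have "(1 - c) * sec (space N') x = ((1 - c) * ?m) + (1 - c) * (sec (space N') x - ?m)"
    by (simp add: algebra_simps)
  also have "(1 - c) * ?m < \<epsilon>" using 1 by (simp add: algebra_simps abs_if split: if_splits)
  also have "(1 - c) * (sec (space N') x - ?m) \<le> 1 * \<epsilon>"
    using 2 c \<open>\<epsilon> > 0\<close> by (intro order_trans[OF mult_left_mono[of _ \<epsilon>] mult_right_mono]) auto
  finally show False using \<open>\<epsilon> > 0\<close> unfolding \<epsilon>_def by simp
qed

text \<open>Integration over fibres turns measurability of \<open>sec B\<close> over the factor into
  \<open>sec B x = c * \<kappa>' (p x) B\<close>, where \<open>c\<close> is the constant measure of the sections in the other
  direction; approximating \<open>A0\<^sub>x\<close> by sets \<open>B\<close> then leaves only \<open>c = 0\<close> and \<open>c = 1\<close>.\<close>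

lemma trivial_if_not_enlarged:
  assumes same: "enlarged = factor_subalgebra X Y p"
    and c: "AE x' in X'. emeasure (\<kappa> (p' x')) (Pair x' -` (prod.swap -` A0 \<inter> space (N' \<Otimes>\<^sub>M N))) = ennreal c"
    and c0: "0 \<le> c"
  shows "(\<integral>\<^sup>+y. emeasure (\<kappa> y \<Otimes>\<^sub>M \<kappa>' y) A0 \<partial>Y) \<in> {0, 1}"
proof -
  interpret W: extension_pair G X' T' Y S p' N' \<kappa>' X T p N \<kappa> by (rule swapped)
  \<comment> \<open>The joining measure of \<open>A0\<close>, restricted to base points in
    \<open>C\<close> and second coordinates in \<open>B\<close>, is computed in both orders;
    integrating over \<open>X\<close> first leaves the constant \<open>c\<close>.\<close>
  have int: "(\<integral>\<^sup>+x. ennreal (sec B x) * indicator C (p x) \<partial>X)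
      = ennreal c * (\<integral>\<^sup>+x. emeasure (\<kappa>' (p x)) B * indicator C (p x) \<partial>X)"
    (is "?l = ennreal c * ?r") if B: "B \<in> sets N'" and C: "C \<in> sets Y" for B C
  proof -
    let ?R = "A0 \<inter> (space N \<times> B)"
    have R: "?R \<in> sets (N \<Otimes>\<^sub>M N')" using A0 B by auto
    have "?l = (\<integral>\<^sup>+x. emeasure (\<kappa>' (p x)) (Pair x -` ?R) * indicator C (p x) \<partial>X)"
    proof (rule nn_integral_cong)
      fix x assume x: "x \<in> space X"
      interpret F: prob_space "\<kappa>' (p x)" using fibre_facts[OF x] by simp
      have "Pair x -` ?R = Pair x -` A0 \<inter> B" using x E1.space_X by auto
      then show "ennreal (sec B x) * indicator C (p x) = emeasure (\<kappa>' (p x)) (Pair x -` ?R) * indicator C (p x)"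
        by (simp add: sec_def F.emeasure_eq_measure)
    qed
    also have "\<dots> = (\<integral>\<^sup>+y\<in>C. emeasure (\<kappa> y \<Otimes>\<^sub>M \<kappa>' y) ?R \<partial>Y)"
      by (rule section_integral[OF R C])
    also have "\<dots> = (\<integral>\<^sup>+y\<in>C. emeasure (\<kappa>' y \<Otimes>\<^sub>M \<kappa> y) (prod.swap -` ?R \<inter> space (N' \<Otimes>\<^sub>M N)) \<partial>Y)"
      by (intro nn_integral_cong) (simp only: emeasure_swap[OF R])
    also have "\<dots> = (\<integral>\<^sup>+x'. emeasure (\<kappa> (p' x')) (Pair x' -` (prod.swap -` ?R \<inter> space (N' \<Otimes>\<^sub>M N))) * indicator C (p' x') \<partial>X')"
      by (rule W.section_integral[OF swap_sets[OF R] C, symmetric])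
    also have "\<dots> = (\<integral>\<^sup>+x'. ennreal c * indicator (p' -` C \<inter> B) x' \<partial>X')"
    proof (rule nn_integral_cong_AE)
      show "AE x' in X'. emeasure (\<kappa> (p' x')) (Pair x' -` (prod.swap -` ?R \<inter> space (N' \<Otimes>\<^sub>M N))) * indicator C (p' x')
          = ennreal c * indicator (p' -` C \<inter> B) x'"
        using c AE_space
      proof eventually_elim
        case (elim x')
        have "Pair x' -` (prod.swap -` ?R \<inter> space (N' \<Otimes>\<^sub>M N))
            = (if x' \<in> B then Pair x' -` (prod.swap -` A0 \<inter> space (N' \<Otimes>\<^sub>M N)) else {})"
          using elim(2) E2.space_X by (auto simp: space_pair_measure)
        then show ?case using elim(1) by (simp add: indicator_def)
      qed
    qed
    also have "\<dots> = ennreal c * emeasure X' (p' -` C \<inter> B)"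
    proof (rule nn_integral_cmult_indicator)
      have "p' -` C \<inter> B = (p' -` C \<inter> space X') \<inter> B"
        using sets.sets_into_space[OF B] E2.space_X by auto
      then show "p' -` C \<inter> B \<in> sets X'"
        using sets.Int[OF measurable_sets[OF E2.p_measurable C] E2.sets_N_X[OF B]] by simp
    qed
    also have "emeasure X' (p' -` C \<inter> B) = (\<integral>\<^sup>+y\<in>C. emeasure (\<kappa>' y) B \<partial>Y)"
      by (rule E2.emeasure_fibre_inter[OF C B])
    also have "\<dots> = (\<integral>\<^sup>+y. emeasure (\<kappa>' y) B * indicator C y \<partial>distr X Y p)"
      by (simp only: E1.distr_p)
    also have "\<dots> = ?r"
      by (rule nn_integral_distr[OF E1.p_measurable])
        (simp only: measurable_distr_eq1, intro borel_measurable_times_ennreal E2.\<kappa>_emeasure_measurable[OF B]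
          borel_measurable_indicator C)
    finally show ?thesis .
  qed
  have total: "(\<integral>\<^sup>+y. emeasure (\<kappa> y \<Otimes>\<^sub>M \<kappa>' y) A0 \<partial>Y) = (\<integral>\<^sup>+x. ennreal (sec (space N') x) \<partial>X)"
  proof -
    have "(\<integral>\<^sup>+y. emeasure (\<kappa> y \<Otimes>\<^sub>M \<kappa>' y) A0 \<partial>Y) = (\<integral>\<^sup>+y\<in>space Y. emeasure (\<kappa> y \<Otimes>\<^sub>M \<kappa>' y) A0 \<partial>Y)"
      by (intro nn_integral_cong) simp
    also have "\<dots> = (\<integral>\<^sup>+x. emeasure (\<kappa>' (p x)) (Pair x -` A0) * indicator (space Y) (p x) \<partial>X)"
      by (rule section_integral[OF A0 sets.top, symmetric])
    also have "\<dots> = (\<integral>\<^sup>+x. ennreal (sec (space N') x) \<partial>X)"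
    proof (rule nn_integral_cong)
      fix x assume x: "x \<in> space X"
      interpret F: prob_space "\<kappa>' (p x)" using fibre_facts[OF x] by simp
      show "emeasure (\<kappa>' (p x)) (Pair x -` A0) * indicator (space Y) (p x) = ennreal (sec (space N') x)"
        using measurable_space[OF E1.p_measurable x] sets.sets_into_space[OF fibre_facts(4)[OF x]]
        by (simp add: sec_def F.emeasure_eq_measure Int_absorb2)
    qed
    finally show ?thesis .
  qed
  have total_c: "(\<integral>\<^sup>+x. ennreal (sec (space N') x) \<partial>X) = ennreal c"
  proof -
    have "(\<integral>\<^sup>+x. ennreal (sec (space N') x) \<partial>X) = (\<integral>\<^sup>+x. ennreal (sec (space N') x) * indicator (space Y) (p x) \<partial>X)"
      by (intro nn_integral_cong) (simp add: measurable_space[OF E1.p_measurable])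
    also have "\<dots> = ennreal c * (\<integral>\<^sup>+x. emeasure (\<kappa>' (p x)) (space N') * indicator (space Y) (p x) \<partial>X)"
      by (rule int[OF sets.top sets.top])
    also have "(\<integral>\<^sup>+x. emeasure (\<kappa>' (p x)) (space N') * indicator (space Y) (p x) \<partial>X) = (\<integral>\<^sup>+x. 1 \<partial>X)"
    proof (rule nn_integral_cong)
      fix x assume x: "x \<in> space X"
      show "emeasure (\<kappa>' (p x)) (space N') * indicator (space Y) (p x) = 1"
        using measurable_space[OF E1.p_measurable x] prob_space.emeasure_space_1[OF fibre_facts(1)[OF x]]
        by (simp add: fibre_facts(3)[OF x])
    qed
    finally show ?thesis by (simp add: E1.X.emeasure_space_1)
  qed
  have "(\<integral>\<^sup>+x. ennreal (sec (space N') x) \<partial>X) \<le> (\<integral>\<^sup>+x. 1 \<partial>X)"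
    by (intro nn_integral_mono) (simp add: sec_le_1)
  then have c1: "c \<le> 1" unfolding total_c by (simp add: E1.X.emeasure_space_1)
  have sub: "complete_invariant_subalgebra G X T enlarged" "factor_subalgebra X Y p \<subseteq> enlarged"
    by (rule enlarged_subalgebra)+
  have proportional: "AE x in X. sec B x = c * measure (\<kappa>' (p x)) B" if B: "B \<in> sets N'" for B
  proof -
    let ?h = "\<lambda>x. c * measure (\<kappa>' (p x)) B"
    have fm: "sec B \<in> borel_measurable (sigma (space X) enlarged)" by (rule enlarged_subalgebra(3)[OF B])
    have hm: "?h \<in> borel_measurable (sigma (space X) enlarged)"
      by (intro borel_measurable_times borel_measurable_const fibre_measure_measurable_subalgebra[OF sub B])
    have meas_X: "f \<in> borel_measurable X" if "f \<in> borel_measurable (sigma (space X) enlarged)" for f :: "'a \<Rightarrow> real"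
      using measurable_sets[OF that] E1.X.subalgebraD(2)[OF sub(1)]
      by (intro measurableI) (auto simp: E1.X.space_subalgebra E1.X.sets_subalgebra[OF sub(1)])
    \<comment> \<open>By \<open>same\<close>, a set of \<open>enlarged\<close> is a preimage from
      the factor up to a null set, so \<open>int\<close> applies to it; as \<open>sec B\<close> and
      \<open>?h\<close> are both measurable for \<open>enlarged\<close>, this determines
      them.\<close>
    have eq: "(\<integral>\<^sup>+x\<in>W. ennreal (sec B x) \<partial>X) = (\<integral>\<^sup>+x\<in>W. ennreal (?h x) \<partial>X)" if W: "W \<in> enlarged" for W
    proof -
      obtain C where C: "C \<in> sets Y" "emeasure X (sym_diff (p -` C \<inter> space X) W) = 0" and WX: "W \<in> sets X"
        using W unfolding same factor_subalgebra_def by blast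
      have pC: "p -` C \<inter> space X \<in> sets X" using measurable_sets[OF E1.p_measurable C(1)] .
      have "sym_diff (p -` C \<inter> space X) W \<in> null_sets X"
        using C(2) pC WX by (auto simp: null_sets_def)
      from AE_not_in[OF this]
      have ae: "AE x in X. x \<in> W \<longleftrightarrow> p x \<in> C" using AE_space by eventually_elim auto
      have "(\<integral>\<^sup>+x\<in>W. ennreal (sec B x) \<partial>X) = (\<integral>\<^sup>+x. ennreal (sec B x) * indicator C (p x) \<partial>X)"
        using ae by (intro nn_integral_cong_AE, eventually_elim) (simp add: indicator_def)
      also have "\<dots> = ennreal c * (\<integral>\<^sup>+x. emeasure (\<kappa>' (p x)) B * indicator C (p x) \<partial>X)"
        by (rule int[OF B C(1)])
      also have "\<dots> = (\<integral>\<^sup>+x. ennreal c * (emeasure (\<kappa>' (p x)) B * indicator C (p x)) \<partial>X)"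
        by (rule nn_integral_cmult[symmetric])
          (intro borel_measurable_times_ennreal measurable_compose[OF E1.p_measurable]
            E2.\<kappa>_emeasure_measurable[OF B] borel_measurable_indicator C(1))
      also have "\<dots> = (\<integral>\<^sup>+x\<in>W. ennreal (?h x) \<partial>X)"
      proof (rule nn_integral_cong_AE)
        show "AE x in X. ennreal c * (emeasure (\<kappa>' (p x)) B * indicator C (p x)) = ennreal (?h x) * indicator W x"
          using ae AE_space
        proof eventually_elim
          case (elim x)
          interpret F: prob_space "\<kappa>' (p x)" using fibre_facts[OF elim(2)] by simp
          show ?case using elim(1) c0 by (simp add: F.emeasure_eq_measure ennreal_mult indicator_def)
        qed
      qed
      finally show ?thesis .
    qed
    have lt: "{x\<in>space X. f x < h x} \<in> enlarged"
      if "f \<in> borel_measurable (sigma (space X) enlarged)" "h \<in> borel_measurable (sigma (space X) enlarged)" for f h :: "'a \<Rightarrow> real"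
      using borel_measurable_less[OF that] by (simp add: E1.X.space_subalgebra E1.X.sets_subalgebra[OF sub(1)])
    have h0: "0 \<le> ?h x" for x using c0 by simp
    have h1: "?h x \<le> 1" if "x \<in> space X" for x
      using c0 c1 prob_space.prob_le_1[OF fibre_facts(1)[OF that]] by (intro mult_le_one) auto
    have fin: "(\<integral>\<^sup>+x. ennreal (f x) \<partial>X) \<noteq> \<infinity>" if "\<And>x. x \<in> space X \<Longrightarrow> f x \<le> 1" for f :: "'a \<Rightarrow> real"
    proof -
      have "(\<integral>\<^sup>+x. ennreal (f x) \<partial>X) \<le> (\<integral>\<^sup>+x. 1 \<partial>X)"
        by (intro nn_integral_mono) (simp add: that)
      also have "\<dots> = 1" by (simp add: E1.X.emeasure_space_1)
      finally show ?thesis by (auto simp: top_unique)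
    qed
    have "AE x in X. sec B x \<le> ?h x"
      by (rule AE_le_if_superlevel_integrals_eq[OF meas_X[OF fm] meas_X[OF hm] h0 fin[OF h1] eq[OF lt[OF hm fm]]])
    moreover have "AE x in X. ?h x \<le> sec B x"
      by (rule AE_le_if_superlevel_integrals_eq[OF meas_X[OF hm] meas_X[OF fm] sec_nonneg fin[OF sec_le_1]
          eq[OF lt[OF fm hm], symmetric]])
    ultimately show ?thesis by eventually_elim simp
  qed
  show ?thesis
  \<comment> \<open>The measure of the invariant set equals \<open>c\<close>. If \<open>c\<close> is
    below 1, almost every section is null and the measure is 0.\<close>
  proof (cases "c = 1")
    case True
    then show ?thesis using total total_c by simp
  next
    case False
    have "standard_borel N'" using E2.model unfolding borel_model_def by blast
    then obtain \<V> where V: "countable \<V>" "algebra (space N') \<V>" "sets N' = sigma_sets (space N') \<V>"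
      by (rule standard_borel_countable_algebra)
    have "AE x in X. \<forall>B\<in>\<V>. sec B x = c * measure (\<kappa>' (p x)) B"
      by (intro AE_ball_countable[OF V(1), THEN iffD2] ballI proportional) (simp add: V(3))
    then have "AE x in X. ennreal (sec (space N') x) = 0"
      using AE_space
    proof eventually_elim
      case (elim x)
      have "sec (space N') x = 0"
        using elim c0 c1 False by (intro section_null_of_proportional[OF V(2,3) elim(2)]) auto
      then show ?case by simp
    qed
    then have "(\<integral>\<^sup>+x. ennreal (sec (space N') x) \<partial>X) = (\<integral>\<^sup>+x. 0 \<partial>X)" by (rule nn_integral_cong_AE)
    then show ?thesis using total by simp
  qed
qed

end

theorem theorem2:
  fixes G :: "('g, 'm) monoid_scheme"
    and X :: "'a measure" and T :: "'g \<Rightarrow> 'a \<Rightarrow> 'a"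
    and Y :: "'b measure" and S :: "'g \<Rightarrow> 'b \<Rightarrow> 'b" and p :: "'a \<Rightarrow> 'b"
  assumes "dynamical_system G X T"
    and "ergodic G X T"
    and "pinsker_factor G X T Y S p"
    and "nonatomic Y"
  shows "relatively_weakly_mixing TYPE('c) G X T Y S p"
  unfolding relatively_weakly_mixing_def
proof (intro conjI allI impI)
  show factor: "factor_map G X T Y S p" using assms(3) unfolding pinsker_factor_def by blast
  fix X' :: "'c measure" and T' p' J
  assume factor': "factor_map G X' T' Y S p'" and erg': "ergodic G X' T'"
    and J: "relatively_independent_joining X p X' p' Y J"
  obtain N N' \<kappa> \<kappa>' where NN: "borel_model N X" "borel_model N' X'" "disintegration N Y p \<kappa>"
    "disintegration N' Y p' \<kappa>'" and J_eq: "J = completion (Giry_Monad.bind Y (\<lambda>y. \<kappa> y \<Otimes>\<^sub>M \<kappa>' y))"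
    using J unfolding relatively_independent_joining_def by blast
  interpret E: extension_pair G X T Y S p N \<kappa> X' T' p' N' \<kappa>'
    using factor factor' NN by unfold_locales
  interpret E': extension_pair G X' T' Y S p' N' \<kappa>' X T p N \<kappa> by (rule E.swapped)
  define P where "P = Giry_Monad.bind Y (\<lambda>y. \<kappa> y \<Otimes>\<^sub>M \<kappa>' y)"
  have K: "(\<lambda>y. \<kappa> y \<Otimes>\<^sub>M \<kappa>' y) \<in> Y \<rightarrow>\<^sub>M subprob_algebra (N \<Otimes>\<^sub>M N')"
    by (intro measurable_prob_algebraD measurable_pair_prob E.E1.\<kappa>_measurable E.E2.\<kappa>_measurable)
  have sets_P: "sets P = sets (N \<Otimes>\<^sub>M N')"
    unfolding P_def using sets_bind[OF sets_kernel[OF K] E.E1.Y.not_empty] .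
  then have space_P: "space P = space N \<times> space N'"
    using sets_eq_imp_space_eq[OF sets_P] by (simp add: space_pair_measure)
  have emeasure_P: "emeasure P R = (\<integral>\<^sup>+y. emeasure (\<kappa> y \<Otimes>\<^sub>M \<kappa>' y) R \<partial>Y)" if "R \<in> sets (N \<Otimes>\<^sub>M N')" for R
    unfolding P_def using emeasure_bind[OF E.E1.Y.not_empty K that] .
  show "ergodic G J (diagonal_action X T X' T')"
    unfolding ergodic_def
  proof (intro ballI impI)
    fix A assume A: "A \<in> sets J" and inv: "\<forall>g\<in>carrier G. diagonal_action X T X' T' g ` A = A"
    have J_P: "J = completion P" by (simp add: J_eq P_def)
    obtain A0 Q R where A0: "A = A0 \<union> Q" "Q \<subseteq> R" "R \<in> null_sets P" "A0 \<in> sets P"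
      using A unfolding J_P by (rule sets_completionE)
    have AS: "A \<subseteq> space X \<times> space X'"
      using sets.sets_into_space[OF A] by (simp add: J_P space_P E.E1.space_X E.E2.space_X)
    have A0N: "A0 \<in> sets (N \<Otimes>\<^sub>M N')" using A0(4) sets_P by simp
    have RN: "R \<in> sets (N \<Otimes>\<^sub>M N')" using null_setsD2[OF A0(3)] sets_P by simp
    have R0: "(\<integral>\<^sup>+y. emeasure (\<kappa> y \<Otimes>\<^sub>M \<kappa>' y) R \<partial>Y) = 0"
      using null_setsD1[OF A0(3)] emeasure_P[OF RN] by simp
    \<comment> \<open>Equality of \<open>A\<close> with its image gives one direction at once; the
      other uses that \<open>T g\<close> and \<open>T' g\<close> are injective.\<close>
    have A_inv: "(T g x, T' g x') \<in> A \<longleftrightarrow> (x, x') \<in> A"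
      if g: "g \<in> carrier G" and x: "x \<in> space X" "x' \<in> space X'" for g x x'
    proof
      assume "(x, x') \<in> A"
      then have "diagonal_action X T X' T' g (x, x') \<in> A" using inv g by blast
      then show "(T g x, T' g x') \<in> A" using x by (simp add: diagonal_action_def)
    next
      assume "(T g x, T' g x') \<in> A"
      then have "(T g x, T' g x') \<in> diagonal_action X T X' T' g ` A" using inv g by blast
      then obtain a a' where a: "(a, a') \<in> A" "(T g x, T' g x') = diagonal_action X T X' T' g (a, a')" by auto
      then have "a \<in> space X" "a' \<in> space X'" using AS by auto
      then have "T g x = T g a" "T' g x' = T' g a'" using a(2) by (auto simp: diagonal_action_def)
      then have "x = a" "x' = a'"
        using inj_onD[OF E.E1.X.inj_prop[OF g]] inj_onD[OF E.E2.X.inj_prop[OF g]] x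
          \<open>a \<in> space X\<close> \<open>a' \<in> space X'\<close> by auto
      then show "(x, x') \<in> A" using a(1) by simp
    qed
    have A_A0: "z \<notin> R \<Longrightarrow> z \<in> A \<longleftrightarrow> z \<in> A0" for z using A0(1,2) by auto
    interpret I: invariant_pair G X T Y S p N \<kappa> X' T' p' N' \<kappa>' A A0
    proof unfold_locales
      show "AE x in X. AE x' in \<kappa>' (p x). (x, x') \<in> A \<longleftrightarrow> (x, x') \<in> A0"
        using E.AE_section[OF RN R0]
      proof eventually_elim
        case (elim x)
        then show ?case by eventually_elim (rule A_A0)
      qed
    qed (use A0N A_inv in auto)
    let ?s = "\<lambda>R. prod.swap -` R \<inter> space (N' \<Otimes>\<^sub>M N)"
    \<comment> \<open>The exchanged pair supplies the constant: by ergodicity of \<open>X'\<close>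
      its sections have constant measure.\<close>
    interpret I': invariant_pair G X' T' Y S p' N' \<kappa>' X T p N \<kappa> "prod.swap -` A" "?s A0"
    proof unfold_locales
      have "(\<integral>\<^sup>+y. emeasure (\<kappa>' y \<Otimes>\<^sub>M \<kappa> y) (?s R) \<partial>Y) = (\<integral>\<^sup>+y. emeasure (\<kappa> y \<Otimes>\<^sub>M \<kappa>' y) R \<partial>Y)"
        by (intro nn_integral_cong E.emeasure_swap[OF RN])
      then have "(\<integral>\<^sup>+y. emeasure (\<kappa>' y \<Otimes>\<^sub>M \<kappa> y) (?s R) \<partial>Y) = 0" using R0 by simp
      from E'.AE_section[OF E.swap_sets[OF RN] this]
      show "AE x' in X'. AE x in \<kappa> (p' x'). (x', x) \<in> prod.swap -` A \<longleftrightarrow> (x', x) \<in> ?s A0"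
        using AE_space
      proof eventually_elim
        case (elim x')
        have sp: "space (\<kappa> (p' x')) = space N"
          using E.E1.space_\<kappa>[OF measurable_space[OF E.E2.p_measurable elim(2)]] .
        show ?case using elim(1) AE_space
        proof eventually_elim
          case (elim x)
          have "(x', x) \<in> space (N' \<Otimes>\<^sub>M N)"
            using elim(2) sp \<open>x' \<in> space X'\<close> E.E2.space_X by (simp add: space_pair_measure)
          then show ?case using elim(1) A_A0[of "(x, x')"] by auto
        qed
      qed
    qed (use E.swap_sets[OF A0N] A_inv in auto)
    have pins: "pinsker_subalgebra G X T (factor_subalgebra X Y p)"
      using assms(3) unfolding pinsker_factor_def by blast
    then have zero: "zero_entropy_subalgebra G X T (factor_subalgebra X Y p)"
      unfolding pinsker_subalgebra_def by blast
    \<comment> \<open>Maximality of the Pinsker subalgebra is applied to \<open>enlarged\<close>,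
      which contains it and has zero entropy.\<close>
    have same: "I.enlarged = factor_subalgebra X Y p"
      using pins I.enlarged_zero_entropy[OF assms(2,4) zero] I.enlarged_subalgebra(2)
      unfolding pinsker_subalgebra_def by blast
    define c where "c = (\<integral>x'. I'.sec (space N) x' \<partial>X')"
    have c0: "0 \<le> c" unfolding c_def by (intro integral_nonneg_AE AE_I2 I'.sec_nonneg)
    have "AE x' in X'. emeasure (\<kappa> (p' x')) (Pair x' -` (?s A0)) = ennreal c"
      using I'.sec_space_const[OF erg'] AE_space
    proof eventually_elim
      case (elim x')
      interpret F: prob_space "\<kappa> (p' x')" using I'.fibre_facts[OF elim(2)] by simp
      have "Pair x' -` (?s A0) \<inter> space N = Pair x' -` (?s A0)"
        using sets.sets_into_space[OF I'.fibre_facts(4)[OF elim(2)]] by (rule Int_absorb2)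
      then have "I'.sec (space N) x' = F.prob (Pair x' -` (?s A0))"
        unfolding I'.sec_def by (rule arg_cong)
      then show ?case
        using elim(1) unfolding c_def[symmetric] by (simp only: F.emeasure_eq_measure)
    qed
    from I.trivial_if_not_enlarged[OF same this c0]
    have "emeasure P A0 \<in> {0, 1}" using emeasure_P[OF A0N] by simp
    moreover have "emeasure J A = emeasure P A0"
    proof -
      have "AE z in J. z \<in> A \<longleftrightarrow> z \<in> A0"
        unfolding J_P AE_completion_iff using AE_not_in[OF A0(3)] by eventually_elim (rule A_A0)
      then have "emeasure J A = emeasure J A0"
        using A A0(4) by (intro emeasure_eq_AE) (auto simp: J_P)
      then show ?thesis using A0(4) by (simp add: J_P)
    qed
    ultimately show "emeasure J A = 0 \<or> emeasure J A = 1" by auto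
  qed
qed

end
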